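(* Let $\mu$ denote the Hausdorff probability measure on the Sierpinski gasket $SG$ and let $\psi$ be the state on $C(SG)$ defined by $\psi(f)=\int_{SG}f(t)\,d\mu(t)$ for $f\in C(SG)$. For each natural number $n$ let $\psi_n$ be the state on $C(SG)$ defined by $$\psi_n(f)=3^{-(n+1)}\sum_{i=1}^{3^n}\sum_{j=1}^{3}f(x_{n,i,j}),\qquad f\in C(SG),$$ where $x_{n,i,1},x_{n,i,2},x_{n,i,3}$ are the midpoints of the three sides of the triangle $\Delta_{n,i}$ of $SG_n$ (see context). Then the sequence of states $(\psi_n)_{n\in\mathbb{N}}$ converges to $\psi$ in the weak*-topology on the dual of $C(SG)$.
   Context: The Sierpinski gasket: let $SG_0\subset\mathbb{R}^2$ be the boundary (three sides) of an equilateral triangle with side length $2\pi/3$ and vertices $v_1,v_2,v_3$. Let $F_j(x)=(x+v_j)/2$, $j=1,2,3$. Let $SG_n$ be the union of the $3^n$ triangles $F_{j_1}\circ\cdots\circ F_{j_n}(SG_0)$, each an equilateral triangle (boundary only) of side length $2^{1-n}\pi/3$; number these triangles $\Delta_{n,i}$, $1\le i\le 3^n$. Then $SG$ is the closure of $\bigcup_n SG_n$; the midpoints $x_{n,i,j}$ lie in $SG$. The Hausdorff probability measure $\mu$ on $SG$ is the normalization to total mass $1$ of the restriction to $SG$ of the Hausdorff measure of dimension $\log3/\log2$. $C(SG)$ is the algebra of complex continuous functions on $SG$. *)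

theory Defs
  imports "HOL-Analysis.Analysis"
begin

section \<open>Hausdorff measure\<close>

text \<open>
  Intended for \<open>s > 0\<close>: since \<open>0 powr s = 0\<close>, sets of diameter zero cost nothing, and the
  countable covers below include the finite ones (pad with the empty set).  Boundedness is
  required because \<^const>\<open>diameter\<close> is meaningless on unbounded sets.  No normalising constant
  is included; it would cancel in the probability measure below.
\<close>

definition hausdorff_outer :: "real \<Rightarrow> 'a::metric_space set \<Rightarrow> ennreal" where
  "hausdorff_outer s A =
     (SUP \<delta>\<in>{0<..}.
        INF U\<in>{U :: nat \<Rightarrow> 'a set. A \<subseteq> (\<Union>k. U k) \<and> (\<forall>k. bounded (U k) \<and> diameter (U k) \<le> \<delta>)}.
          (\<Sum>k. ennreal (diameter (U k) powr s)))"

definition hausdorff_measure :: "real \<Rightarrow> 'a::metric_space measure" where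
  "hausdorff_measure s = measure_of UNIV (sets borel) (hausdorff_outer s)"


section \<open>The Sierpinski gasket\<close>

text \<open>
  The vertices are \<open>v 1, v 2, v 3\<close>; side \<open>j\<close> of the triangle joins \<open>v j\<close> to
  \<open>v (j mod 3 + 1)\<close>.  A word \<open>[j\<^sub>1, \<dots>, j\<^sub>n]\<close> over \<open>{1, 2, 3}\<close> encodes the map
  \<open>F\<^bsub>j\<^sub>1\<^esub> \<circ> \<cdots> \<circ> F\<^bsub>j\<^sub>n\<^esub>\<close>, and thereby one of the \<open>3^n\<close> triangles making up level \<open>n\<close>.
\<close>

type_synonym plane = "real ^ 2"

definition equilateral :: "real \<Rightarrow> (nat \<Rightarrow> plane) \<Rightarrow> bool" where
  "equilateral s v \<longleftrightarrow> (\<forall>i\<in>{1..3}. \<forall>j\<in>{1..3}. i \<noteq> j \<longrightarrow> dist (v i) (v j) = s)"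

definition SG_base :: "(nat \<Rightarrow> plane) \<Rightarrow> plane set" where
  "SG_base v = (\<Union>j\<in>{1..3}. closed_segment (v j) (v (j mod 3 + 1)))"

definition SG_map :: "(nat \<Rightarrow> plane) \<Rightarrow> nat \<Rightarrow> plane \<Rightarrow> plane" where
  "SG_map v j x = (1/2) *\<^sub>R (x + v j)"

definition words :: "nat \<Rightarrow> nat list set" where
  "words n = {js. length js = n \<and> set js \<subseteq> {1..3}}"

definition SG_word_map :: "(nat \<Rightarrow> plane) \<Rightarrow> nat list \<Rightarrow> plane \<Rightarrow> plane" where
  "SG_word_map v js = foldr (SG_map v) js"

definition SG_level :: "(nat \<Rightarrow> plane) \<Rightarrow> nat \<Rightarrow> plane set" where
  "SG_level v n = (\<Union>js\<in>words n. SG_word_map v js ` SG_base v)"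

definition SG :: "(nat \<Rightarrow> plane) \<Rightarrow> plane set" where
  "SG v = closure (\<Union>n. SG_level v n)"

definition side_midpoint :: "(nat \<Rightarrow> plane) \<Rightarrow> nat list \<Rightarrow> nat \<Rightarrow> plane" where
  "side_midpoint v js j =
     midpoint (SG_word_map v js (v j)) (SG_word_map v js (v (j mod 3 + 1)))"

definition SG_measure :: "(nat \<Rightarrow> plane) \<Rightarrow> plane measure" where
  "SG_measure v =
     (let H = hausdorff_measure (ln 3 / ln 2)
      in scale_measure (1 / emeasure H (SG v)) (restrict_space H (SG v)))"


section \<open>The dual of \<open>C(K)\<close>, the weak-star topology, and states\<close>

text \<open>
  The library's space of bounded continuous functions with the sup metric.  Its elements are
  extensional (\<^const>\<open>undefined\<close> outside \<open>K\<close>), so that they correspond exactly to functions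
  on \<open>K\<close>; hence the use of restricted abstractions below.  For compact \<open>K\<close>, boundedness is
  automatic and this is the usual \<open>C(K)\<close>.
\<close>

abbreviation C_metric :: "'a::topological_space set \<Rightarrow> ('a \<Rightarrow> complex) metric" where
  "C_metric K \<equiv> cfunspace (top_of_set K) euclidean_metric"

abbreviation C_space :: "'a::topological_space set \<Rightarrow> ('a \<Rightarrow> complex) set" where
  "C_space K \<equiv> mspace (C_metric K)"

text \<open>Functionals are likewise extensional on \<open>C(K)\<close>.\<close>

definition C_dual :: "'a::topological_space set \<Rightarrow> (('a \<Rightarrow> complex) \<Rightarrow> complex) set" where
  "C_dual K =
     {\<phi> \<in> extensional (C_space K).
        (\<forall>f\<in>C_space K. \<forall>g\<in>C_space K. \<phi> (\<lambda>x\<in>K. f x + g x) = \<phi> f + \<phi> g) \<and>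
        (\<forall>c. \<forall>f\<in>C_space K. \<phi> (\<lambda>x\<in>K. c * f x) = c * \<phi> f) \<and>
        continuous_map (mtopology_of (C_metric K)) euclidean \<phi>}"

text \<open>The coarsest topology on the dual making all evaluations \<open>\<phi> \<mapsto> \<phi> f\<close> continuous.\<close>

definition weak_star :: "'a::topological_space set \<Rightarrow> (('a \<Rightarrow> complex) \<Rightarrow> complex) topology" where
  "weak_star K = subtopology (product_topology (\<lambda>_. euclidean) (C_space K)) (C_dual K)"

text \<open>States: positive functionals of norm one.\<close>

definition C_states :: "'a::topological_space set \<Rightarrow> (('a \<Rightarrow> complex) \<Rightarrow> complex) set" where
  "C_states K =
     {\<phi> \<in> C_dual K.
        (\<forall>f\<in>C_space K. (\<forall>x\<in>K. f x \<in> \<real>\<^sub>\<ge>\<^sub>0) \<longrightarrow> \<phi> f \<in> \<real>\<^sub>\<ge>\<^sub>0) \<and>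
        (SUP f\<in>{f \<in> C_space K. \<forall>x\<in>K. norm (f x) \<le> 1}. norm (\<phi> f)) = 1}"


section \<open>The functionals\<close>

definition psi :: "(nat \<Rightarrow> plane) \<Rightarrow> (plane \<Rightarrow> complex) \<Rightarrow> complex" where
  "psi v = (\<lambda>f\<in>C_space (SG v). \<integral>t. f t \<partial>SG_measure v)"

text \<open>\<open>w n i\<close> is the word encoding the \<open>i\<close>-th triangle of level \<open>n\<close>.\<close>

definition psi_n ::
    "(nat \<Rightarrow> plane) \<Rightarrow> (nat \<Rightarrow> nat \<Rightarrow> nat list) \<Rightarrow> nat \<Rightarrow> (plane \<Rightarrow> complex) \<Rightarrow> complex" where
  "psi_n v w n =
     (\<lambda>f\<in>C_space (SG v). 1 / 3 ^ (n + 1) * (\<Sum>i=1..3^n. \<Sum>j=1..3. f (side_midpoint v (w n i) j)))"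

end

theory Submission
  imports Defs
begin

text \<open>
  Let \<open>s = ln 3 / ln 2\<close>.  The gasket is the union of its \<open>3^n\<close> cells of level \<open>n\<close>, each a copy of it
  scaled by \<open>1 / 2^n\<close>, so the \<open>s\<close>-dimensional Hausdorff measure of a cell is at most \<open>1 / 3^n\<close> of the
  total.  The total is positive and finite, and the cells cover the gasket, so these bounds are equalities
  and the cells overlap in null sets only.  A continuous function varies little on the cells of a high
  level, so its integral is close to the average over all cells of any of its mean values on the cells,
  in particular of the means over the midpoints.

  Positivity is a counting argument: a ball of radius \<open>r\<close> contains a fixed corner of at most
  \<open>C * r powr s * 3^N\<close> cells of a high level \<open>N\<close>.  A cover of the compact gasket may be replaced by
  finitely many balls, which together contain all \<open>3^N\<close> corners, whence \<open>1 \<le> C * (\<Sum>k. r k powr s)\<close>.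
\<close>

section \<open>Metric outer measures and the Hausdorff measure\<close>

lemma sum_even_odd_split:
  fixes g :: "nat \<Rightarrow> 'a::comm_monoid_add"
  shows "(\<Sum>k<2 * n. g k) = (\<Sum>k<n. g (2 * k)) + (\<Sum>k<n. g (2 * k + 1))"
  by (induction n) (simp_all add: ac_simps)

text \<open>A finite total forces finite terms, so the claim reduces to the tails of a convergent
  real series.\<close>

lemma ennreal_suminf_tail_less:
  fixes f :: "nat \<Rightarrow> ennreal"
  assumes "(\<Sum>i. f i) \<noteq> top" "e > 0"
  shows "\<exists>n. (\<Sum>i. f (i + n)) \<le> ennreal e"
proof -
  have "f i \<noteq> top" for i
    using assms(1) ennreal_suminf_lessD[of f top i] by (simp add: less_top)
  then have f: "f = (\<lambda>i. ennreal (enn2real (f i)))"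
    by (simp add: less_top)
  define r where "r = (\<lambda>i. enn2real (f i))"
  have fr: "f i = ennreal (r i)" for i
    using fun_cong[OF f] by (simp add: r_def)
  have r0: "0 \<le> r i" for i by (simp add: r_def)
  have sm: "summable r"
    using assms(1) by (intro summable_suminf_not_top r0) (simp add: fr)
  obtain n where n: "norm (\<Sum>i. r (i + n)) < e"
    using suminf_exist_split[OF \<open>e > 0\<close> sm] by auto
  have "(\<Sum>i. f (i + n)) = ennreal (\<Sum>i. r (i + n))"
    unfolding fr using sm r0 by (intro suminf_ennreal2) (auto simp: summable_iff_shift)
  also have "\<dots> \<le> ennreal e" using n by (intro ennreal_leI) simp
  finally show ?thesis by blast
qed

lemma countable_subadditive_binary:
  fixes f :: "'a set \<Rightarrow> ennreal"
  assumes empty: "f {} = 0"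
    and csub: "\<And>A :: nat \<Rightarrow> 'a set. f (\<Union>i. A i) \<le> (\<Sum>i. f (A i))"
  shows "f (A \<union> B) \<le> f A + f B"
proof -
  define S where "S = (\<lambda>i::nat. if i = 0 then A else if i = 1 then B else {})"
  have "f (A \<union> B) = f (\<Union>i. S i)"
    by (rule arg_cong[of _ _ f]) (auto simp: S_def split: if_splits)
  also have "\<dots> \<le> (\<Sum>i. f (S i))" by (rule csub)
  also have "\<dots> = (\<Sum>i\<in>{0,1}. f (S i))"
    by (rule suminf_finite) (auto simp: S_def empty)
  also have "\<dots> = f A + f B" by (simp add: S_def)
  finally show ?thesis .
qed

lemma countable_subadditive_finite:
  fixes f :: "'a set \<Rightarrow> ennreal"
  assumes empty: "f {} = 0"
    and csub: "\<And>A :: nat \<Rightarrow> 'a set. f (\<Union>i. A i) \<le> (\<Sum>i. f (A i))"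
    and "finite I"
  shows "f (\<Union>i\<in>I. A i) \<le> (\<Sum>i\<in>I. f (A i))"
  using \<open>finite I\<close>
proof induction
  case (insert i I)
  then have "f (\<Union>j\<in>insert i I. A j) \<le> f (A i) + f (\<Union>j\<in>I. A j)"
    using countable_subadditive_binary[OF empty csub, of "A i"] by simp
  also have "\<dots> \<le> f (A i) + (\<Sum>j\<in>I. f (A j))" by (intro add_left_mono insert)
  finally show ?case using insert by simp
qed (simp add: empty)

text \<open>Caratheodory's argument: exhaust \<open>A - C\<close> by the sets \<open>B n\<close> at
  positive distance from \<open>C\<close>, for which \<open>sep\<close> gives additivity. What
  \<open>B n\<close> misses consists of the rings \<open>R k\<close> with \<open>k \<ge> n\<close>.
  Every other ring is separated from the previous ones, so the even and the odd rings each have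
  total at most \<open>f A\<close>; if that is finite, the tail of the series over all rings is
  small.\<close>

lemma metric_outer_measure_closed:
  fixes f :: "'a::metric_space set \<Rightarrow> ennreal"
  assumes empty: "f {} = 0"
    and mono: "\<And>A B. A \<subseteq> B \<Longrightarrow> f A \<le> f B"
    and csub: "\<And>A :: nat \<Rightarrow> 'a set. f (\<Union>i. A i) \<le> (\<Sum>i. f (A i))"
    and sep: "\<And>A B e. 0 < e \<Longrightarrow> (\<And>x y. x \<in> A \<Longrightarrow> y \<in> B \<Longrightarrow> e \<le> dist x y) \<Longrightarrow> f A + f B \<le> f (A \<union> B)"
    and "closed C"
  shows "f (A \<inter> C) + f (A - C) \<le> f A"
proof (cases "C = {}")
  case True
  then show ?thesis by (simp add: empty)
next
  case False
  note sub2 = countable_subadditive_binary[of f, OF empty csub]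
  define d where "d x = infdist x C" for x
  have d_tri: "d x - d y \<le> dist x y" for x y
    using infdist_triangle[of x C y] by (simp add: d_def)
  define B where "B n = {x \<in> A. 1 / real (n + 1) \<le> d x}" for n
  define R where "R n = {x \<in> A. 1 / real (n + 2) \<le> d x \<and> d x < 1 / real (n + 1)}" for n
  \<comment> \<open>The cases \<open>p = 0\<close> and \<open>p = 1\<close> are the even and the odd
    rings; skipping one ring leaves a gap to which \<open>sep\<close> applies.\<close>
  have parity: "(\<Sum>k<n. f (R (2 * k + p))) \<le> f (\<Union>k<n. R (2 * k + p))" for p n
  proof (induction n)
    case 0
    then show ?case by (simp add: empty)
  next
    case (Suc n)
    let ?U = "\<Union>k<n. R (2 * k + p)"
    have "\<exists>e>0. \<forall>x\<in>?U. \<forall>y\<in>R (2 * n + p). e \<le> dist x y"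
    \<comment> \<open>For \<open>n = 0\<close> the union is empty and any gap will do; the general
      formula would divide by zero when \<open>p = 0\<close>.\<close>
    proof (cases "n = 0")
      case False
      \<comment> \<open>The earlier rings stay at distance at least \<open>1 / (2 * n + p)\<close>
        from \<open>C\<close>, the new one below \<open>1 / (2 * n + p + 1)\<close>; since
        \<open>d\<close> is 1-Lipschitz, the difference is a gap.\<close>
      let ?e = "1 / real (2 * n + p) - 1 / real (2 * n + p + 1)"
      have "1 / real (2 * n + p + 1) < 1 / real (2 * n + p)"
        using False by (intro divide_strict_left_mono) auto
      then have "?e > 0" by simp
      moreover have "?e \<le> dist x y" if xy: "x \<in> ?U" "y \<in> R (2 * n + p)" for x y
      proof -
        obtain k where k: "k < n" "x \<in> R (2 * k + p)" using xy by auto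
        have "1 / real (2 * n + p) \<le> 1 / real (2 * k + p + 2)"
          using k False by (intro divide_left_mono) auto
        also have "\<dots> \<le> d x" using k by (simp add: R_def)
        finally have "1 / real (2 * n + p) \<le> d x" .
        moreover have "d y < 1 / real (2 * n + p + 1)" using xy by (simp add: R_def)
        ultimately show ?thesis using d_tri[of x y] by linarith
      qed
      ultimately show ?thesis by blast
    qed (auto intro: exI[of _ 1])
    then obtain e where "e > 0" "\<forall>x\<in>?U. \<forall>y\<in>R (2 * n + p). e \<le> dist x y" by blast
    then have "f ?U + f (R (2 * n + p)) \<le> f (?U \<union> R (2 * n + p))"
      by (intro sep[of e]) auto
    moreover have "?U \<union> R (2 * n + p) = (\<Union>k<Suc n. R (2 * k + p))"
      by (auto simp: less_Suc_eq)
    ultimately show ?case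
      using order_trans[OF add_right_mono[OF Suc.IH, of "f (R (2 * n + p))"]] by simp
  qed
  have parity': "(\<Sum>k<n. f (R (2 * k + p))) \<le> f A" for p n
    by (rule order_trans[OF parity mono]) (auto simp: R_def)
  show ?thesis
  proof (rule ennreal_le_epsilon)
    fix e :: real assume fin: "f A < top" and "0 < e"
    have "(\<Sum>k. f (R k)) \<le> f A + f A"
    proof (rule suminf_le_const)
      fix n
      have "(\<Sum>k<n. f (R k)) \<le> (\<Sum>k<2 * n. f (R k))" by (intro sum_mono2) auto
      also have "\<dots> \<le> f A + f A"
        unfolding sum_even_odd_split using parity'[of 0 n] parity'[of 1 n] by (intro add_mono) auto
      finally show "(\<Sum>k<n. f (R k)) \<le> f A + f A" .
    qed simp
    also have "\<dots> < top" using fin by simp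
    finally have "(\<Sum>k. f (R k)) \<noteq> top" by simp
    then obtain n where n: "(\<Sum>i. f (R (i + n))) \<le> ennreal e"
      using ennreal_suminf_tail_less[OF _ \<open>0 < e\<close>] by blast
    have "A - C \<subseteq> B n \<union> (\<Union>i. R (i + n))"
    proof
      fix x assume x: "x \<in> A - C"
      have "d x \<noteq> 0"
        unfolding d_def using x in_closed_iff_infdist_zero[OF \<open>closed C\<close> False] by auto
      then have "d x > 0" using infdist_nonneg[of x C] by (simp add: d_def)
      then obtain m0 where "1 / real (Suc m0) < d x" using nat_approx_posE by blast
      then have ex: "\<exists>m. 1 / real (m + 1) \<le> d x" by (auto intro!: exI[of _ m0])
      \<comment> \<open>Minimality locates \<open>x\<close>: if \<open>m > 0\<close> then
        \<open>x\<close> lies in the ring \<open>R (m - 1)\<close>, which belongs to the tail as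
        soon as \<open>m > n\<close>.\<close>
      define m where "m = (LEAST m. 1 / real (m + 1) \<le> d x)"
      have m: "1 / real (m + 1) \<le> d x" unfolding m_def by (rule LeastI_ex[OF ex])
      show "x \<in> B n \<union> (\<Union>i. R (i + n))"
      proof (cases "m \<le> n")
        case True
        have "1 / real (n + 1) \<le> 1 / real (m + 1)" using True by (intro divide_left_mono) auto
        with m x show ?thesis by (auto simp: B_def)
      next
        case False
        define i where "i = m - 1 - n"
        have i: "m = Suc (i + n)" using False by (simp add: i_def)
        have "\<not> 1 / real (i + n + 1) \<le> d x"
          using not_less_Least[of "i + n" "\<lambda>m. 1 / real (m + 1) \<le> d x"] i by (simp add: m_def)
        then have "x \<in> R (i + n)" using m x by (auto simp: R_def i add.commute)
        then show ?thesis by blast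
      qed
    qed
    then have "f (A - C) \<le> f (B n \<union> (\<Union>i. R (i + n)))" by (rule mono)
    also have "\<dots> \<le> f (B n) + f (\<Union>i. R (i + n))" by (rule sub2)
    also have "\<dots> \<le> f (B n) + ennreal e" by (intro add_left_mono order_trans[OF csub n])
    finally have "f (A \<inter> C) + f (A - C) \<le> f (A \<inter> C) + f (B n) + ennreal e"
      by (simp add: add.assoc add_left_mono)
    also have "f (A \<inter> C) + f (B n) \<le> f (A \<inter> C \<union> B n)"
    proof (rule sep)
      show "0 < 1 / real (n + 1)" by simp
    next
      fix x y assume xy: "x \<in> A \<inter> C" "y \<in> B n"
      then have "d x = 0" by (simp add: d_def)
      then show "1 / real (n + 1) \<le> dist x y"
        using xy d_tri[of y x] by (simp add: B_def dist_commute)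
    qed
    also have "\<dots> \<le> f A" by (rule mono) (auto simp: B_def)
    finally show "f (A \<inter> C) + f (A - C) \<le> f A + ennreal e" by (simp add: add_right_mono)
  qed
qed

text \<open>By Caratheodory's theorem \<open>f\<close> is a measure on the sigma-algebra of its
  measurable sets, which contains the closed sets and hence all Borel sets.\<close>

lemma metric_outer_measure_space_borel:
  fixes f :: "'a::metric_space set \<Rightarrow> ennreal"
  assumes empty: "f {} = 0"
    and mono: "\<And>A B. A \<subseteq> B \<Longrightarrow> f A \<le> f B"
    and csub: "\<And>A :: nat \<Rightarrow> 'a set. f (\<Union>i. A i) \<le> (\<Sum>i. f (A i))"
    and sep: "\<And>A B e. 0 < e \<Longrightarrow> (\<And>x y. x \<in> A \<Longrightarrow> y \<in> B \<Longrightarrow> e \<le> dist x y) \<Longrightarrow> f A + f B \<le> f (A \<union> B)"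
  shows "measure_space UNIV (sets borel) f"
proof -
  interpret P: sigma_algebra "UNIV :: 'a set" UNIV
    using sigma_algebra_Pow[of "UNIV :: 'a set"] by simp
  let ?L = "lambda_system UNIV UNIV f"
  have "outer_measure_space UNIV f"
    using mono csub empty
    by (auto simp: outer_measure_space_def positive_def increasing_def countably_subadditive_def)
  then have L: "measure_space UNIV ?L f" by (rule P.caratheodory_lemma)
  have closed: "C \<in> ?L" if "closed C" for C
  proof -
    have "f (A \<inter> C) + f (A - C) = f A" for A
    proof (rule antisym)
      show "f (A \<inter> C) + f (A - C) \<le> f A"
        by (rule metric_outer_measure_closed[OF empty mono csub sep that])
      show "f A \<le> f (A \<inter> C) + f (A - C)"
        using countable_subadditive_binary[of f "A \<inter> C" "A - C", OF empty csub] by (simp add: Int_Diff_Un)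
    qed
    then show ?thesis by (simp add: P.lambda_system_eq)
  qed
  have "sigma_algebra UNIV ?L" using L by (simp add: measure_space_def)
  then have "sigma_sets UNIV {C. closed C} \<subseteq> ?L"
    using closed by (intro sigma_algebra.sigma_sets_subset) auto
  then have "sets borel \<subseteq> ?L" by (simp add: borel_eq_closed)
  then show ?thesis
    using L sets.sigma_algebra_axioms[of "borel :: 'a measure"]
    by (auto simp: measure_space_def positive_def countably_additive_def)
qed

section \<open>Hausdorff contents at a fixed scale\<close>

definition hausdorff_content :: "real \<Rightarrow> real \<Rightarrow> 'a::metric_space set \<Rightarrow> ennreal" where
  "hausdorff_content s \<delta> A =
     (INF U\<in>{U :: nat \<Rightarrow> 'a set. A \<subseteq> (\<Union>k. U k) \<and> (\<forall>k. bounded (U k) \<and> diameter (U k) \<le> \<delta>)}.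
        (\<Sum>k. ennreal (diameter (U k) powr s)))"

lemma hausdorff_outer_eq: "hausdorff_outer s A = (SUP \<delta>\<in>{0<..}. hausdorff_content s \<delta> A)"
  by (simp add: hausdorff_outer_def hausdorff_content_def)

lemma hausdorff_content_le_outer: "0 < \<delta> \<Longrightarrow> hausdorff_content s \<delta> A \<le> hausdorff_outer s A"
  unfolding hausdorff_outer_eq by (rule SUP_upper) simp

lemma hausdorff_content_le:
  assumes "A \<subseteq> (\<Union>k. U k)" "\<And>k. bounded (U k)" "\<And>k. diameter (U k) \<le> \<delta>"
  shows "hausdorff_content s \<delta> A \<le> (\<Sum>k. ennreal (diameter (U k) powr s))"
  unfolding hausdorff_content_def using assms by (intro INF_lower) auto

lemma hausdorff_content_le_diameter:
  assumes "bounded A" "diameter A \<le> \<delta>" "0 \<le> \<delta>"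
  shows "hausdorff_content s \<delta> A \<le> ennreal (diameter A powr s)"
proof -
  define U where "U = (\<lambda>k::nat. if k = 0 then A else {})"
  have "hausdorff_content s \<delta> A \<le> (\<Sum>k. ennreal (diameter (U k) powr s))"
    using assms by (intro hausdorff_content_le) (auto simp: U_def split: if_splits)
  also have "\<dots> = (\<Sum>k\<in>{0}. ennreal (diameter (U k) powr s))"
    by (rule suminf_finite) (auto simp: U_def)
  finally show ?thesis by (simp add: U_def)
qed

lemma hausdorff_content_mono: "A \<subseteq> B \<Longrightarrow> hausdorff_content s \<delta> A \<le> hausdorff_content s \<delta> B"
  unfolding hausdorff_content_def by (intro INF_superset_mono) auto

lemma hausdorff_content_antimono:
  "\<delta> \<le> \<delta>' \<Longrightarrow> hausdorff_content s \<delta>' A \<le> hausdorff_content s \<delta> A"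
  unfolding hausdorff_content_def by (intro INF_superset_mono) (auto intro: order_trans)

lemma hausdorff_content_empty: "0 \<le> \<delta> \<Longrightarrow> hausdorff_content s \<delta> {} = 0"
  using hausdorff_content_le_diameter[of "{}" \<delta> s] by simp

text \<open>Cover \<open>A i\<close> with an excess of at most \<open>e / 2 ^ (i + 1)\<close> and
  merge all these covers into one sequence along the pairing function.\<close>

lemma hausdorff_content_UN_le:
  fixes A :: "nat \<Rightarrow> 'a::metric_space set"
  shows "hausdorff_content s \<delta> (\<Union>i. A i) \<le> (\<Sum>i. hausdorff_content s \<delta> (A i))"
proof (rule ennreal_le_epsilon)
  fix e :: real assume fin: "(\<Sum>i. hausdorff_content s \<delta> (A i)) < top" and "0 < e"
  have "\<exists>U. A i \<subseteq> (\<Union>k. U k) \<and> (\<forall>k. bounded (U k) \<and> diameter (U k) \<le> \<delta>) \<and>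
      (\<Sum>k. ennreal (diameter (U k :: 'a set) powr s)) \<le> hausdorff_content s \<delta> (A i) + ennreal (e * (1/2) ^ Suc i)"
    for i
  proof -
    have "hausdorff_content s \<delta> (A i) < top"
      using fin ennreal_suminf_lessD by blast
    then have "hausdorff_content s \<delta> (A i) < hausdorff_content s \<delta> (A i) + ennreal (e * (1/2) ^ Suc i)"
      using \<open>0 < e\<close> ennreal_add_left_cancel_less[of "hausdorff_content s \<delta> (A i)" 0 "ennreal (e * (1/2) ^ Suc i)"] by simp
    then show ?thesis
      unfolding hausdorff_content_def[of s \<delta> "A i"]
      unfolding INF_less_iff by (auto intro: less_imp_le)
  qed
  then obtain U where U: "\<And>i. A i \<subseteq> (\<Union>k. U i k)"
    "\<And>i k. bounded (U i k)" "\<And>i k. diameter (U i k) \<le> \<delta>"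
    "\<And>i. (\<Sum>k. ennreal (diameter (U i k :: 'a set) powr s)) \<le> hausdorff_content s \<delta> (A i) + ennreal (e * (1/2) ^ Suc i)"
    by metis
  define V where "V n = (case prod_decode n of (i, k) \<Rightarrow> U i k)" for n
  have "hausdorff_content s \<delta> (\<Union>i. A i) \<le> (\<Sum>n. ennreal (diameter (V n) powr s))"
  proof (rule hausdorff_content_le)
    show "(\<Union>i. A i) \<subseteq> (\<Union>n. V n)"
    proof
      fix x assume "x \<in> (\<Union>i. A i)"
      then obtain i k where "x \<in> U i k" using U(1) by blast
      then have "x \<in> V (prod_encode (i, k))" by (simp add: V_def)
      then show "x \<in> (\<Union>n. V n)" by blast
    qed
  qed (auto simp: V_def U split: prod.split)
  also have "\<dots> = (\<Sum>n. case prod_decode n of (i, k) \<Rightarrow> ennreal (diameter (U i k) powr s))"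
    by (auto simp: V_def intro!: arg_cong[of _ _ suminf] split: prod.split)
  also have "\<dots> = (\<Sum>i. \<Sum>k. ennreal (diameter (U i k) powr s))"
    by (rule suminf_ennreal_2dimen) simp
  also have "\<dots> \<le> (\<Sum>i. hausdorff_content s \<delta> (A i) + ennreal (e * (1/2) ^ Suc i))"
    by (intro suminf_le U) auto
  also have "\<dots> = (\<Sum>i. hausdorff_content s \<delta> (A i)) + (\<Sum>i. ennreal (e * (1/2) ^ Suc i))"
    by (rule suminf_add[symmetric]) auto
  also have "(\<Sum>i. ennreal (e * (1/2) ^ Suc i)) = ennreal e"
    using \<open>0 < e\<close> sums_mult[OF power_half_series, of e] by (intro suminf_ennreal_eq) auto
  finally show "hausdorff_content s \<delta> (\<Union>i. A i) \<le> (\<Sum>i. hausdorff_content s \<delta> (A i)) + ennreal e" .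
qed

text \<open>A set of diameter at most \<open>\<delta>\<close> cannot meet both \<open>A\<close> and
  \<open>B\<close>, so every cover of the union splits into a cover of \<open>A\<close> and a cover
  of \<open>B\<close> that share no contribution.\<close>

lemma hausdorff_content_separated:
  fixes A B :: "'a::metric_space set"
  assumes sep: "\<And>x y. x \<in> A \<Longrightarrow> y \<in> B \<Longrightarrow> e \<le> dist x y" and "\<delta> < e" "0 \<le> \<delta>"
  shows "hausdorff_content s \<delta> A + hausdorff_content s \<delta> B \<le> hausdorff_content s \<delta> (A \<union> B)"
  unfolding hausdorff_content_def[of s \<delta> "A \<union> B"]
proof (rule INF_greatest, clarify)
  fix U :: "nat \<Rightarrow> 'a set"
  assume U: "A \<union> B \<subseteq> (\<Union>k. U k)" "\<forall>k. bounded (U k) \<and> diameter (U k) \<le> \<delta>"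
  \<comment> \<open>Discarded members become empty rather than being removed: they then cost
    \<open>0 powr s = 0\<close> and the indexing stays unchanged.\<close>
  define V where "V S k = (if U k \<inter> S = {} then {} else U k)" for S k
  have content: "hausdorff_content s \<delta> S \<le> (\<Sum>k. ennreal (diameter (V S k) powr s))" if S: "S \<subseteq> A \<union> B" for S
  proof (rule hausdorff_content_le)
    show "S \<subseteq> (\<Union>k. V S k)"
    proof
      fix x assume x: "x \<in> S"
      then obtain k where "x \<in> U k" using S U(1) by blast
      then have "x \<in> V S k" using x by (auto simp: V_def)
      then show "x \<in> (\<Union>k. V S k)" by blast
    qed
  qed (use U(2) \<open>0 \<le> \<delta>\<close> in \<open>auto simp: V_def\<close>)
  have disj: "U k \<inter> A = {} \<or> U k \<inter> B = {}" for k
  proof (rule ccontr)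
    assume "\<not> ?thesis"
    then obtain x y where xy: "x \<in> U k" "y \<in> U k" "x \<in> A" "y \<in> B" by blast
    then have "dist x y \<le> \<delta>" using diameter_bounded_bound[of "U k" x y] U(2) by (meson order_trans)
    then show False using sep[of x y] xy \<open>\<delta> < e\<close> by linarith
  qed
  have "hausdorff_content s \<delta> A + hausdorff_content s \<delta> B
      \<le> (\<Sum>k. ennreal (diameter (V A k) powr s)) + (\<Sum>k. ennreal (diameter (V B k) powr s))"
    by (intro add_mono content) auto
  also have "\<dots> = (\<Sum>k. ennreal (diameter (V A k) powr s) + ennreal (diameter (V B k) powr s))"
    by (rule suminf_add) auto
  also have "\<dots> \<le> (\<Sum>k. ennreal (diameter (U k) powr s))"
    using disj by (intro suminf_le) (auto simp: V_def)
  finally show "hausdorff_content s \<delta> A + hausdorff_content s \<delta> B \<le> (\<Sum>k. ennreal (diameter (U k) powr s))" .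
qed

section \<open>The Hausdorff outer measure and its restriction to Borel sets\<close>

lemma hausdorff_outer_empty: "hausdorff_outer s {} = 0"
  unfolding hausdorff_outer_eq by (rule antisym) (auto intro!: SUP_least simp: hausdorff_content_empty)

lemma hausdorff_outer_mono: "A \<subseteq> B \<Longrightarrow> hausdorff_outer s A \<le> hausdorff_outer s B"
  unfolding hausdorff_outer_eq by (intro SUP_mono') (rule hausdorff_content_mono)

lemma hausdorff_outer_UN_le:
  "hausdorff_outer s (\<Union>i::nat. A i) \<le> (\<Sum>i. hausdorff_outer s (A i))"
  unfolding hausdorff_outer_eq[of s "\<Union>i. A i"]
proof (rule SUP_least)
  fix \<delta> :: real assume "\<delta> \<in> {0<..}"
  then have "(\<Sum>i. hausdorff_content s \<delta> (A i)) \<le> (\<Sum>i. hausdorff_outer s (A i))"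
    by (intro suminf_le hausdorff_content_le_outer) auto
  with hausdorff_content_UN_le show "hausdorff_content s \<delta> (\<Union>i. A i) \<le> (\<Sum>i. hausdorff_outer s (A i))"
    by (rule order_trans)
qed

text \<open>The two suprema on the left run over independent scales; contents grow as the scale
  shrinks, so both may be replaced by a common scale below the gap \<open>e\<close>.\<close>

lemma hausdorff_outer_separated:
  assumes "0 < e" and sep: "\<And>x y. x \<in> A \<Longrightarrow> y \<in> B \<Longrightarrow> e \<le> dist x y"
  shows "hausdorff_outer s A + hausdorff_outer s B \<le> hausdorff_outer s (A \<union> B)"
proof -
  have "hausdorff_content s \<delta> A + hausdorff_content s \<delta>' B \<le> hausdorff_outer s (A \<union> B)"
    if "0 < \<delta>" "0 < \<delta>'" for \<delta> \<delta>'
  proof -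
    define \<eta> where "\<eta> = min (e / 2) (min \<delta> \<delta>')"
    have \<eta>: "0 < \<eta>" "\<eta> < e" "\<eta> \<le> \<delta>" "\<eta> \<le> \<delta>'" using that \<open>0 < e\<close> by (auto simp: \<eta>_def)
    have "hausdorff_content s \<delta> A + hausdorff_content s \<delta>' B
        \<le> hausdorff_content s \<eta> A + hausdorff_content s \<eta> B"
      by (intro add_mono hausdorff_content_antimono \<eta>)
    also have "\<dots> \<le> hausdorff_content s \<eta> (A \<union> B)"
      using \<eta> by (intro hausdorff_content_separated[OF sep]) auto
    also have "\<dots> \<le> hausdorff_outer s (A \<union> B)" by (rule hausdorff_content_le_outer[OF \<eta>(1)])
    finally show ?thesis .
  qed
  then have "hausdorff_content s \<delta> A + hausdorff_outer s B \<le> hausdorff_outer s (A \<union> B)" if "0 < \<delta>" for \<delta>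
    using that unfolding hausdorff_outer_eq[of s B]
    by (subst ennreal_SUP_add_right) (auto intro!: SUP_least)
  then show ?thesis
    unfolding hausdorff_outer_eq[of s A]
    by (subst ennreal_SUP_add_left[symmetric]) (auto intro!: SUP_least)
qed

lemma space_hausdorff_measure [simp]: "space (hausdorff_measure s) = UNIV"
  and sets_hausdorff_measure [simp]: "sets (hausdorff_measure s) = sets borel"
  using sets.sigma_sets_eq[of borel] by (simp_all add: hausdorff_measure_def space_measure_of_conv sets_measure_of_conv)

lemma emeasure_hausdorff_measure:
  assumes "A \<in> sets borel"
  shows "emeasure (hausdorff_measure s) A = hausdorff_outer s A"
proof -
  have "measure_space UNIV (sets borel) (hausdorff_outer s :: 'a set \<Rightarrow> ennreal)"
    by (intro metric_outer_measure_space_borel hausdorff_outer_empty hausdorff_outer_mono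
        hausdorff_outer_UN_le hausdorff_outer_separated)
  then show ?thesis
    unfolding hausdorff_measure_def using assms
    by (intro emeasure_measure_of_sigma) (auto simp: measure_space_def)
qed

section \<open>Hausdorff measure of Lipschitz images\<close>

lemma ennreal_le_mult_if_divide_le:
  fixes c :: ennreal
  assumes "c \<noteq> 0" "c \<noteq> top" "x / c \<le> y"
  shows "x \<le> c * y"
proof -
  have "x = c * (x / c)"
    using assms(1,2) by (simp add: ennreal_times_divide mult.commute[of c] mult_divide_eq_ennreal)
  also have "\<dots> \<le> c * y" by (intro mult_left_mono assms(3)) simp
  finally show ?thesis .
qed

lemma bounded_diameter_Lipschitz_image:
  fixes f :: "'a::metric_space \<Rightarrow> 'b::metric_space"
  assumes lip: "\<And>x y. dist (f x) (f y) \<le> c * dist x y" and "0 \<le> c" "bounded U"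
  shows "bounded (f ` U)" "diameter (f ` U) \<le> c * diameter U"
proof -
  have *: "dist (f x) (f y) \<le> c * diameter U" if "x \<in> U" "y \<in> U" for x y
    using lip[of x y] mult_left_mono[OF diameter_bounded_bound[OF \<open>bounded U\<close> that] \<open>0 \<le> c\<close>] by linarith
  show "bounded (f ` U)"
  proof (cases "U = {}")
    case False
    then obtain x where "x \<in> U" by blast
    then show ?thesis using * by (auto simp: bounded_def)
  qed simp
  show "diameter (f ` U) \<le> c * diameter U"
    using * by (auto simp: diameter_def[of "f ` U"] intro!: cSUP_least)
qed

text \<open>The images of a cover of \<open>A\<close> at scale \<open>\<delta> / c\<close> form a
  cover at scale \<open>\<delta>\<close>, and each power of a diameter gains a factor of at most
  \<open>c powr s\<close>.\<close>

lemma hausdorff_outer_Lipschitz_image: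
  fixes f :: "'a::metric_space \<Rightarrow> 'b::metric_space"
  assumes lip: "\<And>x y. dist (f x) (f y) \<le> c * dist x y" and "0 < c" "0 \<le> s"
  shows "hausdorff_outer s (f ` A) \<le> ennreal (c powr s) * hausdorff_outer s A"
  unfolding hausdorff_outer_eq[of s "f ` A"]
proof (rule SUP_least)
  fix \<delta> :: real assume "\<delta> \<in> {0<..}"
  then have \<delta>: "\<delta> / c > 0" using \<open>0 < c\<close> by simp
  have c0: "ennreal (c powr s) \<noteq> 0" "ennreal (c powr s) \<noteq> top" using \<open>0 < c\<close> by auto
  \<comment> \<open>Dividing by the constant leaves the infimum alone on the right, so that a single
    cover can be treated at a time.\<close>
  have "hausdorff_content s \<delta> (f ` A) / ennreal (c powr s) \<le> hausdorff_content s (\<delta> / c) A"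
    unfolding hausdorff_content_def[of s "\<delta> / c" A]
  proof (rule INF_greatest, clarify)
    fix U :: "nat \<Rightarrow> 'a set"
    assume U: "A \<subseteq> (\<Union>k. U k)" "\<forall>k. bounded (U k) \<and> diameter (U k) \<le> \<delta> / c"
    have Uf: "bounded (f ` U k)" "diameter (f ` U k) \<le> c * diameter (U k)" for k
      using bounded_diameter_Lipschitz_image[OF lip, of "U k"] \<open>0 < c\<close> U(2) by auto
    have "c * diameter (U k) \<le> \<delta>" for k
      using U(2) \<open>0 < c\<close> by (simp add: field_simps)
    with Uf(2) have diam: "diameter (f ` U k) \<le> \<delta>" for k by (rule order_trans)
    have "f ` A \<subseteq> (\<Union>k. f ` U k)" using U(1) by blast
    then have "hausdorff_content s \<delta> (f ` A) \<le> (\<Sum>k. ennreal (diameter (f ` U k) powr s))"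
      using Uf(1) diam by (rule hausdorff_content_le)
    also have "\<dots> \<le> (\<Sum>k. ennreal (c powr s) * ennreal (diameter (U k) powr s))"
    proof (intro suminf_le)
      fix k
      have "diameter (f ` U k) powr s \<le> (c * diameter (U k)) powr s"
        using Uf[of k] \<open>0 \<le> s\<close> by (intro powr_mono2) (auto intro: diameter_ge_0)
      also have "\<dots> = c powr s * diameter (U k) powr s"
        by (rule powr_mult)
      finally show "ennreal (diameter (f ` U k) powr s) \<le> ennreal (c powr s) * ennreal (diameter (U k) powr s)"
        by (simp add: ennreal_leI flip: ennreal_mult)
    qed auto
    also have "\<dots> = ennreal (c powr s) * (\<Sum>k. ennreal (diameter (U k) powr s))" by simp
    finally show "hausdorff_content s \<delta> (f ` A) / ennreal (c powr s) \<le> (\<Sum>k. ennreal (diameter (U k) powr s))"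
      using c0(1) divide_le_posI_ennreal not_gr_zero by blast
  qed
  also have "\<dots> \<le> hausdorff_outer s A" by (rule hausdorff_content_le_outer[OF \<delta>])
  finally show "hausdorff_content s \<delta> (f ` A) \<le> ennreal (c powr s) * hausdorff_outer s A"
    using ennreal_le_mult_if_divide_le c0 by blast
qed

section \<open>Self-similarity of the gasket\<close>

lemma SG_word_map_Nil [simp]: "SG_word_map v [] x = x"
  and SG_word_map_Cons [simp]: "SG_word_map v (j # js) x = SG_map v j (SG_word_map v js x)"
  and SG_word_map_append: "SG_word_map v (us @ ts) x = SG_word_map v us (SG_word_map v ts x)"
  by (simp_all add: SG_word_map_def)

lemma dist_SG_map: "dist (SG_map v j x) (SG_map v j y) = dist x y / 2"
  by (simp add: SG_map_def dist_norm flip: scaleR_diff_right)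

lemma dist_SG_word_map: "dist (SG_word_map v js x) (SG_word_map v js y) = dist x y / 2 ^ length js"
  by (induction js) (simp_all add: dist_SG_map)

lemma SG_map_midpoint: "SG_map v j (midpoint x y) = midpoint (SG_map v j x) (SG_map v j y)"
  by (simp add: SG_map_def midpoint_def vec_eq_iff field_simps)

lemma SG_word_map_midpoint:
  "SG_word_map v js (midpoint x y) = midpoint (SG_word_map v js x) (SG_word_map v js y)"
  by (induction js) (simp_all add: SG_map_midpoint)

lemma words_0 [simp]: "words 0 = {[]}"
  by (auto simp: words_def)

lemma words_Suc: "words (Suc n) = (\<Union>j\<in>{1..3}. (#) j ` words n)"
  by (auto simp: words_def length_Suc_conv)

lemma finite_words [simp]: "finite (words n)"
  using finite_lists_length_eq[of "{1..3::nat}" n] by (simp add: words_def conj_commute)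

lemma card_words: "card (words n) = 3 ^ n"
  using card_lists_length_eq[of "{1..3::nat}" n] by (simp add: words_def conj_commute)

lemma words_add: "words (m + n) \<subseteq> (\<lambda>(us, ts). us @ ts) ` (words m \<times> words n)"
proof
  fix js assume js: "js \<in> words (m + n)"
  then have "take m js \<in> words m" "drop m js \<in> words n"
    by (auto simp: words_def dest: in_set_takeD in_set_dropD)
  then show "js \<in> (\<lambda>(us, ts). us @ ts) ` (words m \<times> words n)"
    by (intro image_eqI[of _ _ "(take m js, drop m js)"]) auto
qed

section \<open>Compactness and decomposition into cells\<close>

lemma SG_level_0: "SG_level v 0 = SG_base v"
  by (simp add: SG_level_def)

lemma SG_level_Suc: "SG_level v (Suc n) = (\<Union>j\<in>{1..3}. SG_map v j ` SG_level v n)"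
  unfolding SG_level_def words_Suc UN_UN_flatten image_UN[of "SG_map v _"] by (simp add: image_image)

text \<open>The two maps contract the segment onto its two halves; the preimage of the point with
  parameter \<open>u\<close> has parameter \<open>2 * u\<close> or \<open>2 * u - 1\<close>.\<close>

lemma closed_segment_subset_SG_map:
  "closed_segment (v i) (v j) \<subseteq>
     SG_map v i ` closed_segment (v i) (v j) \<union> SG_map v j ` closed_segment (v i) (v j)"
proof
  fix p assume "p \<in> closed_segment (v i) (v j)"
  then obtain u where u: "p = (1 - u) *\<^sub>R v i + u *\<^sub>R v j" "0 \<le> u" "u \<le> 1"
    by (auto simp: closed_segment_def)
  show "p \<in> SG_map v i ` closed_segment (v i) (v j) \<union> SG_map v j ` closed_segment (v i) (v j)"
  proof (cases "u \<le> 1 / 2")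
    case True
    let ?q = "(1 - 2 * u) *\<^sub>R v i + (2 * u) *\<^sub>R v j"
    have "p = SG_map v i ?q"
      by (simp add: u SG_map_def vec_eq_iff field_simps)
    moreover have "?q \<in> closed_segment (v i) (v j)"
      using u True by (auto simp: closed_segment_def intro!: exI[of _ "2 * u"])
    ultimately show ?thesis by blast
  next
    case False
    let ?q = "(1 - (2 * u - 1)) *\<^sub>R v i + (2 * u - 1) *\<^sub>R v j"
    have "p = SG_map v j ?q"
      by (simp add: u SG_map_def vec_eq_iff field_simps)
    moreover have "?q \<in> closed_segment (v i) (v j)"
      unfolding closed_segment_def using u False by (intro CollectI exI[of _ "2 * u - 1"]) auto
    ultimately show ?thesis by blast
  qed
qed

lemma SG_base_subset_level: "SG_base v \<subseteq> SG_level v (Suc 0)"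
proof
  fix p assume "p \<in> SG_base v"
  then obtain j where j: "j \<in> {1..3}" "p \<in> closed_segment (v j) (v (j mod 3 + 1))"
    by (auto simp: SG_base_def)
  then have "closed_segment (v j) (v (j mod 3 + 1)) \<subseteq> SG_base v" by (auto simp: SG_base_def)
  with closed_segment_subset_SG_map[of v j "j mod 3 + 1"] j(2)
  have "p \<in> SG_map v j ` SG_base v \<union> SG_map v (j mod 3 + 1) ` SG_base v" by blast
  moreover have "j mod 3 + 1 \<in> {1..3}" by auto
  ultimately show "p \<in> SG_level v (Suc 0)"
    using j(1) unfolding SG_level_Suc SG_level_0 by blast
qed

text \<open>The three maps shift every level up by one, so only level 0 could be lost, and it is
  contained in level 1.\<close>

lemma UN_SG_level_self_similar:
  "(\<Union>n. SG_level v n) = (\<Union>j\<in>{1..3}. SG_map v j ` (\<Union>n. SG_level v n))" (is "?S = ?T")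
proof -
  have T: "?T = (\<Union>n. SG_level v (Suc n))" by (auto simp: SG_level_Suc)
  have "SG_level v n \<subseteq> (\<Union>n. SG_level v (Suc n))" for n
    using SG_base_subset_level[of v] by (cases n) (auto simp: SG_level_0)
  then show ?thesis unfolding T by blast
qed

lemma SG_map_convex_hull:
  assumes "j \<in> I" shows "SG_map v j ` (convex hull (v ` I)) \<subseteq> convex hull (v ` I)"
proof clarify
  fix x assume "x \<in> convex hull (v ` I)"
  moreover have "v j \<in> convex hull (v ` I)" using assms by (simp add: hull_inc)
  ultimately have "(1/2) *\<^sub>R x + (1/2) *\<^sub>R v j \<in> convex hull (v ` I)"
    using convexD[OF convex_convex_hull, of x "v ` I" "v j" "1/2" "1/2"] by simp
  then show "SG_map v j x \<in> convex hull (v ` I)" by (simp add: SG_map_def scaleR_add_right)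
qed

text \<open>Boundedness comes from the filled triangle: it is closed, contains the base, and is
  mapped into itself by each \<open>SG_map\<close>.\<close>

lemma compact_SG: "compact (SG v)"
proof -
  let ?K = "convex hull (v ` {1..3})"
  have K: "compact ?K" by (intro finite_imp_compact_convex_hull) auto
  have "closed_segment (v j) (v (j mod 3 + 1)) \<subseteq> ?K" if "j \<in> {1..3}" for j
    using that by (intro closed_segment_subset_convex_hull hull_inc imageI) auto
  then have base: "SG_base v \<subseteq> ?K" unfolding SG_base_def by blast
  have "SG_level v n \<subseteq> ?K" for n
  proof (induction n)
    case (Suc n)
    then show ?case unfolding SG_level_Suc using SG_map_convex_hull[of _ "{1..3}" v] by blast
  qed (use base in \<open>simp add: SG_level_0\<close>)
  then have "SG v \<subseteq> ?K"
    unfolding SG_def using K by (intro closure_minimal) (auto simp: compact_imp_closed)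
  then have "bounded (SG v)" using K bounded_subset compact_imp_bounded by blast
  then show ?thesis by (simp add: compact_eq_bounded_closed SG_def)
qed

lemma continuous_on_SG_map: "continuous_on S (SG_map v j)"
  unfolding SG_map_def by (intro continuous_intros)

lemma closure_UN_finite: "finite I \<Longrightarrow> closure (\<Union>i\<in>I. A i) = (\<Union>i\<in>I. closure (A i))"
  by (induction rule: finite_induct) (auto simp: closure_Un)

text \<open>Closure commutes with finite unions, and with each \<open>SG_map\<close> because of
  continuity and because the image of a compact set is closed.\<close>

lemma SG_self_similar: "SG v = (\<Union>j\<in>{1..3}. SG_map v j ` SG v)"
proof -
  let ?S = "\<Union>n. SG_level v n"
  have img: "closure (SG_map v j ` ?S) = SG_map v j ` SG v" for j
  proof
    have "closed (SG_map v j ` SG v)"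
      by (intro compact_imp_closed compact_continuous_image continuous_on_SG_map compact_SG)
    then show "closure (SG_map v j ` ?S) \<subseteq> SG_map v j ` SG v"
      using closure_subset[of ?S] by (intro closure_minimal image_mono) (auto simp: SG_def)
    show "SG_map v j ` SG v \<subseteq> closure (SG_map v j ` ?S)"
      unfolding SG_def by (intro image_closure_subset continuous_on_SG_map closure_subset) simp
  qed
  have "SG v = closure (\<Union>j\<in>{1..3}. SG_map v j ` ?S)"
    using UN_SG_level_self_similar[of v] by (simp add: SG_def)
  also have "\<dots> = (\<Union>j\<in>{1..3}. closure (SG_map v j ` ?S))" by (rule closure_UN_finite) simp
  finally show ?thesis by (simp add: img)
qed

lemma SG_eq_UN_cells: "SG v = (\<Union>js\<in>words n. SG_word_map v js ` SG v)"
proof (induction n)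
  case (Suc n)
  have "SG v = (\<Union>j\<in>{1..3}. SG_map v j ` (\<Union>js\<in>words n. SG_word_map v js ` SG v))"
    using SG_self_similar[of v] Suc.IH by simp
  then show ?case
    unfolding words_Suc UN_UN_flatten image_UN[of "SG_map v _"] by (simp add: image_image)
qed simp

lemma SG_word_map_in_SG: "js \<in> words n \<Longrightarrow> x \<in> SG v \<Longrightarrow> SG_word_map v js x \<in> SG v"
  using SG_eq_UN_cells[of v n] by blast

lemma compact_SG_cell: "compact (SG_word_map v js ` SG v)"
proof (induction js)
  case (Cons j js)
  then have "compact (SG_map v j ` SG_word_map v js ` SG v)"
    by (rule compact_continuous_image[OF continuous_on_SG_map])
  then show ?case by (simp add: image_image)
qed (simp add: compact_SG)

lemma SG_base_subset_SG: "SG_base v \<subseteq> SG v"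
  using closure_subset[of "\<Union>n. SG_level v n"] SG_level_0[of v] by (auto simp: SG_def)

lemma side_subset_SG: "j \<in> {1..3} \<Longrightarrow> closed_segment (v j) (v (j mod 3 + 1)) \<subseteq> SG v"
  using SG_base_subset_SG[of v] unfolding SG_base_def by blast

lemma vertex_in_SG: "j \<in> {1..3} \<Longrightarrow> v j \<in> SG v"
  by (rule subsetD[OF side_subset_SG]) auto

text \<open>Cell maps are affine, hence carry the midpoint of a base side to the midpoint of the
  corresponding side of the small triangle.\<close>

lemma side_midpoint_in_cell:
  assumes "j \<in> {1..3}" shows "side_midpoint v js j \<in> SG_word_map v js ` SG v"
proof -
  have "midpoint (v j) (v (j mod 3 + 1)) \<in> SG v"
    by (rule subsetD[OF side_subset_SG[OF assms] midpoint_in_closed_segment])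
  then show ?thesis by (simp add: side_midpoint_def flip: SG_word_map_midpoint)
qed

section \<open>The similarity dimension and finiteness of the measure\<close>

lemma powr_dimension_SG:
  fixes x :: real
  assumes "0 \<le> x" shows "(x / 2 ^ n) powr (ln 3 / ln 2) = x powr (ln 3 / ln 2) / 3 ^ n"
proof -
  have "(2 ^ n) powr (ln 3 / ln 2) = (2 powr (ln 3 / ln 2) :: real) ^ n"
    by (simp add: powr_powr mult.commute flip: powr_realpow)
  \<comment> \<open>This equation determines the exponent: halving lengths divides their powers by
    3, the number of copies.\<close>
  also have "2 powr (ln 3 / ln 2) = (3::real)" by (simp add: powr_def)
  finally show ?thesis using assms by (simp add: powr_divide)
qed

lemma hausdorff_outer_SG_cell_le:
  assumes "js \<in> words n"
  shows "hausdorff_outer (ln 3 / ln 2) (SG_word_map v js ` A) \<le> hausdorff_outer (ln 3 / ln 2) A / 3 ^ n"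
proof -
  have "hausdorff_outer (ln 3 / ln 2) (SG_word_map v js ` A)
      \<le> ennreal ((1 / 2 ^ n) powr (ln 3 / ln 2)) * hausdorff_outer (ln 3 / ln 2) A"
    using assms by (intro hausdorff_outer_Lipschitz_image) (auto simp: dist_SG_word_map words_def)
  also have "ennreal ((1 / 2 ^ n) powr (ln 3 / ln 2)) = 1 / 3 ^ n"
    by (simp add: powr_dimension_SG divide_ennreal[symmetric] ennreal_power[symmetric])
  finally show ?thesis by (simp add: ennreal_divide_times divide_ennreal_def mult.commute)
qed

text \<open>Cells of level \<open>n\<close> have diameter at most \<open>?D / 2 ^ n\<close>. Once
  this is below \<open>\<delta>\<close>, covering by all \<open>3 ^ n\<close> of them costs at most
  \<open>?D powr ?s\<close>, a bound independent of \<open>\<delta>\<close>.\<close>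

lemma hausdorff_outer_SG_finite: "hausdorff_outer (ln 3 / ln 2) (SG v) < top"
proof -
  let ?s = "ln 3 / ln 2" and ?D = "diameter (SG v)"
  have bd: "bounded (SG v)" by (intro compact_imp_bounded compact_SG)
  have D: "0 \<le> ?D" using bd by (rule diameter_ge_0)
  have "hausdorff_content ?s \<delta> (SG v) \<le> ennreal (?D powr ?s)" if "0 < \<delta>" for \<delta>
  proof -
    obtain n where "?D / \<delta> < 2 ^ n" using real_arch_pow[of 2] by auto
    then have n: "?D / 2 ^ n \<le> \<delta>" using that by (simp add: field_simps)
    have cell: "hausdorff_content ?s \<delta> (SG_word_map v js ` SG v) \<le> ennreal (?D powr ?s / 3 ^ n)"
      if js: "js \<in> words n" for js
    proof -
      let ?A = "SG_word_map v js ` SG v"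
      have A: "bounded ?A" "diameter ?A \<le> ?D / 2 ^ n"
        using bounded_diameter_Lipschitz_image[of "SG_word_map v js" "1 / 2 ^ n" "SG v"] bd js
        by (auto simp: dist_SG_word_map words_def)
      have "hausdorff_content ?s \<delta> ?A \<le> ennreal (diameter ?A powr ?s)"
        using A n \<open>0 < \<delta>\<close> by (intro hausdorff_content_le_diameter) auto
      also have "\<dots> \<le> ennreal ((?D / 2 ^ n) powr ?s)"
        using A by (intro ennreal_leI powr_mono2) (auto intro: diameter_ge_0)
      finally show ?thesis using D by (simp add: powr_dimension_SG)
    qed
    have "hausdorff_content ?s \<delta> (SG v) \<le> (\<Sum>js\<in>words n. hausdorff_content ?s \<delta> (SG_word_map v js ` SG v))"
      using countable_subadditive_finite[of "hausdorff_content ?s \<delta>" "words n"] \<open>0 < \<delta>\<close>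
      by (subst SG_eq_UN_cells[of v n]) (simp add: hausdorff_content_empty hausdorff_content_UN_le)
    also have "\<dots> \<le> (\<Sum>js\<in>words n. ennreal (?D powr ?s / 3 ^ n))" by (intro sum_mono cell)
    also have "\<dots> = ennreal (\<Sum>js\<in>words n. ?D powr ?s / 3 ^ n)" by (intro sum_ennreal) simp
    also have "(\<Sum>js\<in>words n. ?D powr ?s / 3 ^ n) = ?D powr ?s" by (simp add: card_words)
    finally show ?thesis .
  qed
  then have "hausdorff_outer ?s (SG v) \<le> ennreal (?D powr ?s)"
    unfolding hausdorff_outer_eq by (intro SUP_least) auto
  then show ?thesis by (simp add: le_less_trans)
qed

section \<open>Positivity of the Hausdorff measure of the gasket\<close>

fun letter_code :: "nat \<Rightarrow> nat list \<Rightarrow> nat" where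
  "letter_code d [] = 0"
| "letter_code d (j # js) = (if j = d then 2 ^ length js else 0) + letter_code d js"

lemma letter_code_less: "letter_code d js < 2 ^ length js"
  by (induction js) auto

text \<open>Each code is a binary number whose digits mark the occurrences of one letter; since the
  remainder is smaller than the leading place value, the digits can be read off. Positions marked by
  neither code hold the letter 1.\<close>

lemma letter_codes_inj:
  assumes "length us = length ts" "set us \<subseteq> {1..3}" "set ts \<subseteq> {1..3}"
    and "letter_code 2 us = letter_code 2 ts" "letter_code 3 us = letter_code 3 ts"
  shows "us = ts"
  using assms
proof (induction us ts rule: list_induct2)
  case (Cons i us j ts)
  have split: "(i = d) = (j = d) \<and> letter_code d us = letter_code d ts"
    if "letter_code d (i # us) = letter_code d (j # ts)" for d
    using that letter_code_less[of d us] letter_code_less[of d ts] Cons.hyps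
    by (auto split: if_splits)
  from split[OF Cons.prems(3)] split[OF Cons.prems(4)] have "(i = 2) = (j = 2)" "(i = 3) = (j = 3)" "us = ts"
    using Cons.IH Cons.prems(1,2) by auto
  moreover have "i \<in> {1, 2, 3}" "j \<in> {1, 2, 3}" using Cons.prems(1,2) by auto
  ultimately show ?case by auto
qed simp

text \<open>
  The binary digits of the coordinates, in the basis of the two sides at \<open>v 1\<close>, of a corner of a cell
  mark the positions of the letters \<open>2\<close> and \<open>3\<close>, so corners of equal level lie on a lattice.
\<close>

lemma SG_map_corner:
  "SG_map v j (v 1 + (1 / 2 ^ n) *\<^sub>R y) = v 1 + (1 / 2 ^ Suc n) *\<^sub>R (2 ^ n *\<^sub>R (v j - v 1) + y)"
  by (simp add: SG_map_def vec_eq_iff field_simps)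

lemma SG_word_map_corner:
  assumes "set js \<subseteq> {1..3}"
  shows "SG_word_map v js (v 1) = v 1 + (1 / 2 ^ length js) *\<^sub>R
    (real (letter_code 2 js) *\<^sub>R (v 2 - v 1) + real (letter_code 3 js) *\<^sub>R (v 3 - v 1))"
  using assms
proof (induction js)
  case (Cons j js)
  then have "j = 1 \<or> j = 2 \<or> j = 3" by auto
  \<comment> \<open>The new first letter adds the place value \<open>2 ^ length js\<close> times
    \<open>v j - v 1\<close>, which vanishes for \<open>j = 1\<close> and otherwise sets the leading
    digit of one code.\<close>
  moreover have "SG_word_map v (j # js) (v 1) = v 1 + (1 / 2 ^ length (j # js)) *\<^sub>R (2 ^ length js *\<^sub>R (v j - v 1) +
      (real (letter_code 2 js) *\<^sub>R (v 2 - v 1) + real (letter_code 3 js) *\<^sub>R (v 3 - v 1)))"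
    using Cons SG_map_corner by (simp del: One_nat_def)
  ultimately show ?case
    by (elim disjE) (simp_all only: letter_code.simps, simp_all add: scaleR_add_left ac_simps)
qed simp

text \<open>The two sides have inner product \<open>L\<^sup>2 / 2\<close>, so the squared norm is
  \<open>L\<^sup>2 * (a\<^sup>2 + a * b + b\<^sup>2)\<close>; completing the square in either
  variable bounds it below. Lattice coordinates are thereby controlled by distances.\<close>

lemma norm_equilateral_ge:
  assumes "equilateral L v" "0 \<le> L"
  shows "L / 2 * \<bar>a\<bar> \<le> norm (a *\<^sub>R (v 2 - v 1) + b *\<^sub>R (v 3 - v 1))" (is ?A)
    and "L / 2 * \<bar>b\<bar> \<le> norm (a *\<^sub>R (v 2 - v 1) + b *\<^sub>R (v 3 - v 1))" (is ?B)
proof -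
  define p q where "p = v 2 - v 1" and "q = v 3 - v 1"
  have "norm p = L" "norm q = L" "norm (p - q) = L"
    using assms(1) by (auto simp: equilateral_def p_def q_def dist_norm)
  then have pq: "p \<bullet> p = L\<^sup>2" "q \<bullet> q = L\<^sup>2" "(p - q) \<bullet> (p - q) = L\<^sup>2"
    by (simp_all flip: power2_norm_eq_inner)
  then have ip: "p \<bullet> q = L\<^sup>2 / 2" by (simp add: inner_diff inner_commute)
  have "(norm (a *\<^sub>R p + b *\<^sub>R q))\<^sup>2 = L\<^sup>2 * (a\<^sup>2 + a * b + b\<^sup>2)"
    unfolding power2_norm_eq_inner
    by (simp add: inner_add pq ip inner_commute[of q p] algebra_simps power2_eq_square)
  moreover have "a\<^sup>2 + a * b + b\<^sup>2 = a\<^sup>2 / 4 + (a + 2 * b)\<^sup>2 / 4 + a\<^sup>2 / 2"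
    "a\<^sup>2 + a * b + b\<^sup>2 = b\<^sup>2 / 4 + (2 * a + b)\<^sup>2 / 4 + b\<^sup>2 / 2"
    by (simp_all add: power2_eq_square field_simps)
  then have "a\<^sup>2 / 4 \<le> a\<^sup>2 + a * b + b\<^sup>2" "b\<^sup>2 / 4 \<le> a\<^sup>2 + a * b + b\<^sup>2"
    using zero_le_power2[of "a + 2 * b"] zero_le_power2[of "2 * a + b"] zero_le_power2[of a] zero_le_power2[of b]
    by linarith+
  ultimately have "L\<^sup>2 * (a\<^sup>2 / 4) \<le> (norm (a *\<^sub>R p + b *\<^sub>R q))\<^sup>2" "L\<^sup>2 * (b\<^sup>2 / 4) \<le> (norm (a *\<^sub>R p + b *\<^sub>R q))\<^sup>2"
    by (simp_all only: mult_left_mono zero_le_power2)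
  then have "(L / 2 * \<bar>a\<bar>)\<^sup>2 \<le> (norm (a *\<^sub>R p + b *\<^sub>R q))\<^sup>2" "(L / 2 * \<bar>b\<bar>)\<^sup>2 \<le> (norm (a *\<^sub>R p + b *\<^sub>R q))\<^sup>2"
    by (simp_all add: power_mult_distrib power_divide)
  then show ?A ?B unfolding p_def q_def by (blast intro: power2_le_imp_le norm_ge_zero)+
qed

text \<open>Two corners in the ball have nearby lattice coordinates, and the coordinates determine
  the word; so it suffices to count the integer points of a square centred at one corner
  \<open>u0\<close> in the ball.\<close>

lemma card_corners_near_same_scale:
  assumes "equilateral L v" "0 < L"
  shows "real (card {us \<in> words m. dist x (SG_word_map v us (v 1)) < R / 2 ^ m}) \<le> (8 * \<bar>R\<bar> / L + 3)\<^sup>2"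
    (is "real (card ?W) \<le> _")
proof (cases "?W = {}")
  case False
  then obtain u0 where u0: "u0 \<in> ?W" by blast
  \<comment> \<open>Two corners in the ball are less than \<open>2 * \<bar>R\<bar> / 2 ^ m\<close>
    apart; removing the lattice scale \<open>1 / 2 ^ m\<close> and the factor \<open>L / 2\<close>
    of \<open>norm_equilateral_ge\<close> leaves \<open>4 * \<bar>R\<bar> / L\<close>.\<close>
  define M where "M = \<lceil>4 * \<bar>R\<bar> / L\<rceil>"
  let ?c = "\<lambda>us. (int (letter_code 2 us), int (letter_code 3 us))"
  have near: "\<bar>int (letter_code d us) - int (letter_code d u0)\<bar> \<le> M"
    if us: "us \<in> ?W" and d: "d = 2 \<or> d = 3" for us d
  proof -
    have len: "length us = m" "length u0 = m" "set us \<subseteq> {1..3}" "set u0 \<subseteq> {1..3}"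
      using us u0 by (auto simp: words_def)
    let ?a = "real (letter_code 2 us) - real (letter_code 2 u0)"
    let ?b = "real (letter_code 3 us) - real (letter_code 3 u0)"
    have "SG_word_map v us (v 1) - SG_word_map v u0 (v 1)
        = (1 / 2 ^ m) *\<^sub>R (?a *\<^sub>R (v 2 - v 1) + ?b *\<^sub>R (v 3 - v 1))"
      unfolding SG_word_map_corner[OF len(3)] SG_word_map_corner[OF len(4)] len
      by (simp add: algebra_simps)
    then have "dist (SG_word_map v us (v 1)) (SG_word_map v u0 (v 1))
        = norm (?a *\<^sub>R (v 2 - v 1) + ?b *\<^sub>R (v 3 - v 1)) / 2 ^ m"
      by (simp add: dist_norm)
    moreover have "dist (SG_word_map v us (v 1)) (SG_word_map v u0 (v 1)) < 2 * \<bar>R\<bar> / 2 ^ m"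
    proof -
      have "dist (SG_word_map v us (v 1)) (SG_word_map v u0 (v 1)) < R / 2 ^ m + R / 2 ^ m"
        using us u0 by (intro dist_triangle_less_add[of _ x]) (auto simp: dist_commute)
      also have "\<dots> \<le> 2 * \<bar>R\<bar> / 2 ^ m" by (simp add: field_simps)
      finally show ?thesis .
    qed
    ultimately have less: "norm (?a *\<^sub>R (v 2 - v 1) + ?b *\<^sub>R (v 3 - v 1)) < 2 * \<bar>R\<bar>"
      by (simp add: divide_less_cancel)
    note ge = norm_equilateral_ge[OF assms(1) less_imp_le[OF assms(2)], where a = "?a" and b = "?b"]
    have "L / 2 * \<bar>?a\<bar> < 2 * \<bar>R\<bar>" "L / 2 * \<bar>?b\<bar> < 2 * \<bar>R\<bar>"
      by (rule le_less_trans[OF ge(1) less], rule le_less_trans[OF ge(2) less])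
    then have "\<bar>?a\<bar> \<le> 4 * \<bar>R\<bar> / L" "\<bar>?b\<bar> \<le> 4 * \<bar>R\<bar> / L"
      using assms(2) by (auto simp: field_simps)
    with d have "\<bar>real (letter_code d us) - real (letter_code d u0)\<bar> \<le> 4 * \<bar>R\<bar> / L" by auto
    then have "of_int \<bar>int (letter_code d us) - int (letter_code d u0)\<bar> \<le> 4 * \<bar>R\<bar> / L" by simp
    then show ?thesis unfolding M_def by linarith
  qed
  have M0: "0 \<le> M" using near[OF u0, of 2] by simp
  let ?I = "\<lambda>d. {int (letter_code d u0) - M .. int (letter_code d u0) + M}"
  have "card ?W \<le> card (?I 2 \<times> ?I 3)"
  proof (rule card_inj_on_le)
    show "inj_on ?c ?W"
      by (rule inj_onI, rule letter_codes_inj) (auto simp: words_def)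
    show "?c ` ?W \<subseteq> ?I 2 \<times> ?I 3"
    proof
      fix z assume "z \<in> ?c ` ?W"
      then obtain us where us: "us \<in> ?W" "z = ?c us" by blast
      show "z \<in> ?I 2 \<times> ?I 3"
        using near[OF us(1) disjI1[OF refl]] near[OF us(1) disjI2[OF refl]]
        unfolding us(2) abs_le_iff by simp
    qed
  qed auto
  also have "\<dots> = (nat (2 * M + 1))\<^sup>2" by (simp add: card_cartesian_product power2_eq_square)
  finally have "real (card ?W) \<le> real ((nat (2 * M + 1))\<^sup>2)" by (simp only: of_nat_le_iff)
  then have "real (card ?W) \<le> (real (nat (2 * M + 1)))\<^sup>2" by (simp only: of_nat_power)
  also have "real (nat (2 * M + 1)) = 2 * real_of_int M + 1" using M0 by simp
  \<comment> \<open>Rounding up costs at most 1 in \<open>M\<close>, which turns the constant 1 into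
    3.\<close>
  also have "(2 * real_of_int M + 1)\<^sup>2 \<le> (8 * \<bar>R\<bar> / L + 3)\<^sup>2"
  proof (rule power_mono)
    have "real_of_int M \<le> 4 * \<bar>R\<bar> / L + 1" unfolding M_def by linarith
    then show "2 * real_of_int M + 1 \<le> 8 * \<bar>R\<bar> / L + 3" by simp
  qed (use M0 in simp)
  finally show ?thesis .
next
  case True
  show ?thesis unfolding True by simp
qed

text \<open>Truncating a word to its first \<open>m\<close> letters moves the corner by at most
  \<open>diameter (SG v) / 2 ^ m\<close>. The prefixes that occur thus have corners in a ball
  comparable with the scale \<open>1 / 2 ^ m\<close>, so their number is bounded, and each has
  \<open>3 ^ (N - m)\<close> extensions.\<close>

lemma card_corners_near:
  assumes "equilateral L v" "0 < L" "m \<le> N" "r \<le> 1 / 2 ^ m"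
  shows "real (card {ws \<in> words N. dist x (SG_word_map v ws (v 1)) < r})
     \<le> (8 * (1 + diameter (SG v)) / L + 3)\<^sup>2 * 3 ^ (N - m)" (is "real (card ?W) \<le> ?C * _")
proof -
  let ?D = "diameter (SG v)"
  let ?V = "{us \<in> words m. dist x (SG_word_map v us (v 1)) < (1 + ?D) / 2 ^ m}"
  have bd: "bounded (SG v)" by (intro compact_imp_bounded compact_SG)
  have D: "0 \<le> ?D" using bd by (rule diameter_ge_0)
  have "?W \<subseteq> (\<lambda>(us, ts). us @ ts) ` (?V \<times> words (N - m))"
  proof
    fix ws assume ws: "ws \<in> ?W"
    then have "ws \<in> words (m + (N - m))" using \<open>m \<le> N\<close> by simp
    then obtain us ts where ut: "ws = us @ ts" "us \<in> words m" "ts \<in> words (N - m)"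
      using words_add[of m "N - m"] by auto
    have v1: "v 1 \<in> SG v" by (intro vertex_in_SG) simp
    have "dist x (SG_word_map v us (v 1))
        \<le> dist x (SG_word_map v ws (v 1)) + dist (SG_word_map v ws (v 1)) (SG_word_map v us (v 1))"
      by (rule dist_triangle)
    also have "dist (SG_word_map v ws (v 1)) (SG_word_map v us (v 1)) = dist (SG_word_map v ts (v 1)) (v 1) / 2 ^ m"
      using ut(2) by (simp add: ut(1) SG_word_map_append dist_SG_word_map words_def)
    also have "\<dots> \<le> ?D / 2 ^ m"
      using bd v1 SG_word_map_in_SG[OF ut(3) v1]
      by (intro divide_right_mono diameter_bounded_bound) auto
    also have "dist x (SG_word_map v ws (v 1)) < 1 / 2 ^ m" using ws assms(4) by simp
    finally have "us \<in> ?V" using ut(2) by (simp add: add_divide_distrib)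
    with ut show "ws \<in> (\<lambda>(us, ts). us @ ts) ` (?V \<times> words (N - m))" by auto
  qed
  then have "card ?W \<le> card ((\<lambda>(us, ts). us @ ts) ` (?V \<times> words (N - m)))"
    by (intro card_mono) auto
  also have "\<dots> \<le> card (?V \<times> words (N - m))" by (intro card_image_le) auto
  also have "\<dots> = card ?V * 3 ^ (N - m)" by (simp add: card_cartesian_product card_words)
  finally have "real (card ?W) \<le> real (card ?V * 3 ^ (N - m))" by (simp only: of_nat_le_iff)
  then have "real (card ?W) \<le> real (card ?V) * 3 ^ (N - m)" by simp
  also have "\<dots> \<le> ?C * 3 ^ (N - m)"
    using card_corners_near_same_scale[OF assms(1,2), of m x "1 + ?D"] D
    by (intro mult_right_mono) auto
  finally show ?thesis .
qed

text \<open>This converts the scale of a ball into a power of its radius, with a constant that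
  serves all centres and radii. Only the level from which the bound holds depends on the
  radius.\<close>

lemma eventually_card_corners_near:
  assumes "equilateral L v" "0 < L"
  shows "\<exists>C\<ge>1. \<forall>x r. 0 < r \<longrightarrow> (\<forall>\<^sub>F N in sequentially.
    real (card {ws \<in> words N. dist x (SG_word_map v ws (v 1)) < r}) \<le> C * r powr (ln 3 / ln 2) * 3 ^ N)"
proof (intro exI conjI allI impI)
  let ?s = "ln 3 / ln 2 :: real" and ?C = "(8 * (1 + diameter (SG v)) / L + 3)\<^sup>2"
  have "0 \<le> diameter (SG v)" by (intro diameter_ge_0 compact_imp_bounded compact_SG)
  then have "1 \<le> 8 * (1 + diameter (SG v)) / L + 3" using assms(2) by simp
  then have C: "1 \<le> ?C" by (rule one_le_power)
  then show "1 \<le> ?C * 3" by simp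
  fix x and r :: real assume "0 < r"
  show "\<forall>\<^sub>F N in sequentially.
    real (card {ws \<in> words N. dist x (SG_word_map v ws (v 1)) < r}) \<le> ?C * 3 * r powr ?s * 3 ^ N"
  proof (cases "r < 1")
    case True
    obtain n0 where "(1 / 2) ^ n0 < r" using real_arch_pow_inv[OF \<open>0 < r\<close>, of "1 / 2"] by auto
    then have ex: "\<exists>n. 1 / 2 ^ n \<le> r" by (auto simp: power_divide intro!: exI[of _ n0])
    \<comment> \<open>The dyadic scale just below \<open>r\<close>; as \<open>r < 1\<close> it is
      not the zeroth, and the preceding scale \<open>1 / 2 ^ m\<close> lies above
      \<open>r\<close>.\<close>
    define n where "n = (LEAST n. 1 / 2 ^ n \<le> r)"
    have n: "1 / 2 ^ n \<le> r" unfolding n_def by (rule LeastI_ex[OF ex])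
    then have "n \<noteq> 0" using True by (cases n) auto
    then obtain m where m: "n = Suc m" by (cases n) auto
    have rm: "r \<le> 1 / 2 ^ m"
      using not_less_Least[of m "\<lambda>n. 1 / 2 ^ n \<le> r"] m by (simp add: n_def)
    have "(1 / 2 ^ n) powr ?s \<le> r powr ?s" using n by (intro powr_mono2) auto
    then have "1 / 3 ^ n \<le> r powr ?s" using powr_dimension_SG[of 1 n] by simp
    \<comment> \<open>The factor 3 is the loss in passing from \<open>n\<close> to
      \<open>m = n - 1\<close>.\<close>
    then have rs: "1 / 3 ^ m \<le> 3 * r powr ?s" by (simp add: m field_simps)
    have "real (card {ws \<in> words N. dist x (SG_word_map v ws (v 1)) < r}) \<le> ?C * 3 * r powr ?s * 3 ^ N"
      if "m \<le> N" for N
    proof -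
      have "real (card {ws \<in> words N. dist x (SG_word_map v ws (v 1)) < r}) \<le> ?C * 3 ^ (N - m)"
        by (rule card_corners_near[OF assms that rm])
      also have "\<dots> = ?C * (1 / 3 ^ m) * 3 ^ N" using that by (simp add: power_diff)
      also have "\<dots> \<le> ?C * (3 * r powr ?s) * 3 ^ N"
        using rs by (intro mult_left_mono mult_right_mono) auto
      finally show ?thesis by (simp add: mult.assoc)
    qed
    then show ?thesis by (auto simp: eventually_sequentially)
  next
    case False
    have "real (card {ws \<in> words N. dist x (SG_word_map v ws (v 1)) < r}) \<le> ?C * 3 * r powr ?s * 3 ^ N" for N
    proof -
      have "card {ws \<in> words N. dist x (SG_word_map v ws (v 1)) < r} \<le> card (words N)"
        by (intro card_mono) auto
      then have "real (card {ws \<in> words N. dist x (SG_word_map v ws (v 1)) < r}) \<le> 3 ^ N"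
        by (simp add: card_words)
      also have "3 ^ N \<le> ?C * 3 * r powr ?s * 3 ^ N"
      proof -
        have "1 \<le> r powr ?s" using False by (intro ge_one_powr_ge_zero) auto
        then have "1 * 1 \<le> ?C * 3 * r powr ?s" using C by (intro mult_mono) auto
        then show ?thesis by simp
      qed
      finally show ?thesis .
    qed
    then show ?thesis by simp
  qed
qed

text \<open>A mass distribution argument with counting in place of a measure: a ball holds at most
  the share \<open>C * r powr ?s\<close> of the corners of a high level, while a cover must account
  for all of them. It is enough to do this at scale 1.\<close>

lemma hausdorff_outer_SG_pos:
  assumes "equilateral L v" "0 < L"
  shows "0 < hausdorff_outer (ln 3 / ln 2) (SG v)"
proof -
  let ?s = "ln 3 / ln 2 :: real"
  have s: "0 < ?s" by simp
  obtain C where C: "1 \<le> C" and count: "\<And>x r. 0 < r \<Longrightarrow> \<forall>\<^sub>F N in sequentially.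
      real (card {ws \<in> words N. dist x (SG_word_map v ws (v 1)) < r}) \<le> C * r powr ?s * 3 ^ N"
    using eventually_card_corners_near[OF assms] by blast
  have "ennreal (1 / (2 * C)) \<le> hausdorff_content ?s 1 (SG v)"
    unfolding hausdorff_content_def
  proof (rule INF_greatest, clarify)
    fix U :: "nat \<Rightarrow> plane set"
    assume U: "SG v \<subseteq> (\<Union>k. U k)" "\<forall>k. bounded (U k) \<and> diameter (U k) \<le> 1"
    define d where "d k = diameter (U k)" for k
    have d0: "0 \<le> d k" for k unfolding d_def using U(2) by (intro diameter_ge_0) auto
    \<comment> \<open>These sum to \<open>1 / (2 * C)\<close>, half of the lower bound
      \<open>1 / C\<close> that the counting yields, so the other half remains for the diameters.
      Being positive, they also enlarge members of diameter zero.\<close>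
    define \<eta> where "\<eta> k = 1 / (4 * C) * (1 / 2) ^ k" for k :: nat
    have \<eta>0: "0 < \<eta> k" for k using C by (simp add: \<eta>_def)
    \<comment> \<open>chosen so that \<open>d k < r k\<close> while the powers exceed those of \<open>d k\<close> by a summable amount\<close>
    define r where "r k = (d k powr ?s + \<eta> k) powr (1 / ?s)" for k
    have rs: "r k powr ?s = d k powr ?s + \<eta> k" for k
      using \<eta>0[of k] by (simp add: r_def powr_powr add_nonneg_nonneg)
    have r0: "0 < r k" for k
    proof -
      have "0 < d k powr ?s + \<eta> k" using \<eta>0[of k] by (simp add: add_nonneg_pos)
      then show ?thesis unfolding r_def by (metis powr_gt_zero less_irrefl)
    qed
    have dr: "d k < r k" for k
    proof (rule ccontr)
      assume "\<not> d k < r k"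
      then have "r k powr ?s \<le> d k powr ?s" using r0[of k] s by (intro powr_mono2) auto
      then show False using rs[of k] \<eta>0[of k] by simp
    qed
    \<comment> \<open>For an empty \<open>U k\<close> the centre is arbitrary, which does no harm
      because extra balls only enlarge the cover.\<close>
    define c where "c k = (SOME x. x \<in> U k)" for k
    have "SG v \<subseteq> (\<Union>k\<in>UNIV. ball (c k) (r k))"
    proof
      fix x assume "x \<in> SG v"
      then obtain k where k: "x \<in> U k" using U(1) by blast
      then have "c k \<in> U k" unfolding c_def by (rule someI)
      then have "dist (c k) x \<le> d k" unfolding d_def using U(2) k by (intro diameter_bounded_bound) auto
      then have "x \<in> ball (c k) (r k)" using dr[of k] by simp
      then show "x \<in> (\<Union>k\<in>UNIV. ball (c k) (r k))" by blast
    qed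
    then obtain K where K: "finite K" "SG v \<subseteq> (\<Union>k\<in>K. ball (c k) (r k))"
      using compactE_image[OF compact_SG, of UNIV "\<lambda>k. ball (c k) (r k)" v] by auto
    \<comment> \<open>Compactness pays off here: for finitely many balls a single level
      \<open>N\<close> serves all the counts.\<close>
    have "\<forall>\<^sub>F N in sequentially. \<forall>k\<in>K.
        real (card {ws \<in> words N. dist (c k) (SG_word_map v ws (v 1)) < r k}) \<le> C * r k powr ?s * 3 ^ N"
      using K(1) count[OF r0] by (simp add: eventually_ball_finite)
    then obtain N where N: "\<And>k. k \<in> K \<Longrightarrow>
        real (card {ws \<in> words N. dist (c k) (SG_word_map v ws (v 1)) < r k}) \<le> C * r k powr ?s * 3 ^ N"
      by (auto simp: eventually_sequentially)
    let ?W = "\<lambda>k. {ws \<in> words N. dist (c k) (SG_word_map v ws (v 1)) < r k}"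
    have "words N \<subseteq> (\<Union>k\<in>K. ?W k)"
    proof
      fix ws assume ws: "ws \<in> words N"
      have "SG_word_map v ws (v 1) \<in> SG v"
        by (intro SG_word_map_in_SG[OF ws] vertex_in_SG) simp
      then have "SG_word_map v ws (v 1) \<in> (\<Union>k\<in>K. ball (c k) (r k))" using K(2) by blast
      then show "ws \<in> (\<Union>k\<in>K. ?W k)" using ws by (auto simp del: One_nat_def)
    qed
    then have "card (words N) \<le> card (\<Union>k\<in>K. ?W k)" using K(1) by (intro card_mono) auto
    also have "\<dots> \<le> (\<Sum>k\<in>K. card (?W k))" by (rule card_UN_le[OF K(1)])
    finally have "real (3 ^ N) \<le> real (\<Sum>k\<in>K. card (?W k))" by (simp only: card_words of_nat_le_iff)
    then have "3 ^ N \<le> (\<Sum>k\<in>K. real (card (?W k)))" by simp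
    also have "\<dots> \<le> (\<Sum>k\<in>K. C * r k powr ?s * 3 ^ N)" by (intro sum_mono N)
    also have "\<dots> = C * (\<Sum>k\<in>K. r k powr ?s) * 3 ^ N" by (simp add: sum_distrib_left sum_distrib_right)
    finally have "1 \<le> C * (\<Sum>k\<in>K. r k powr ?s)" by simp
    then have "1 / C \<le> (\<Sum>k\<in>K. r k powr ?s)" using C by (simp add: field_simps)
    also have "\<dots> = (\<Sum>k\<in>K. d k powr ?s) + (\<Sum>k\<in>K. \<eta> k)" by (simp add: rs sum.distrib)
    also have "(\<Sum>k\<in>K. \<eta> k) \<le> 1 / (2 * C)"
    proof -
      have sums: "\<eta> sums (1 / (2 * C))"
        unfolding \<eta>_def using sums_mult[OF geometric_sums[of "1 / 2 :: real"], of "1 / (4 * C)"] by simp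
      have "(\<Sum>k\<in>K. \<eta> k) \<le> (\<Sum>k. \<eta> k)"
        using sums \<eta>0 K(1) by (intro sum_le_suminf) (auto simp: sums_iff less_imp_le)
      then show ?thesis using sums by (simp add: sums_iff)
    qed
    finally have "1 / (2 * C) \<le> (\<Sum>k\<in>K. d k powr ?s)" using C by (simp add: field_simps)
    then have "ennreal (1 / (2 * C)) \<le> ennreal (\<Sum>k\<in>K. d k powr ?s)" by (rule ennreal_leI)
    also have "\<dots> = (\<Sum>k\<in>K. ennreal (d k powr ?s))" by (simp add: sum_ennreal)
    also have "\<dots> \<le> (\<Sum>k. ennreal (d k powr ?s))" using K(1) by (intro sum_le_suminf) auto
    finally show "ennreal (1 / (2 * C)) \<le> (\<Sum>k. ennreal (diameter (U k) powr ?s))" by (simp add: d_def)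
  qed
  also have "\<dots> \<le> hausdorff_outer ?s (SG v)" by (rule hausdorff_content_le_outer) simp
  finally have "ennreal (1 / (2 * C)) \<le> hausdorff_outer ?s (SG v)" .
  moreover have "0 < ennreal (1 / (2 * C))" using C by simp
  ultimately show ?thesis by (rule less_le_trans[rotated])
qed

section \<open>States on \<open>C(K)\<close>\<close>

lemma mem_C_space_iff:
  assumes "compact K"
  shows "f \<in> C_space K \<longleftrightarrow> f \<in> extensional K \<and> continuous_on K f"
proof -
  have "compactin (top_of_set K) (topspace (top_of_set K))"
    using assms by (simp add: compactin_subtopology)
  from compactin_mspace_cfunspace[OF this, of "euclidean_metric :: complex metric"]
  show ?thesis by (auto simp del: mspace_cfunspace simp: continuous_map_iff_continuous)
qed

lemma restrict_in_C_space:
  assumes "compact K" "continuous_on K f"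
  shows "(\<lambda>x\<in>K. f x) \<in> C_space K"
proof -
  have "continuous_on K (\<lambda>x\<in>K. f x)"
    using assms(2) by (rule continuous_on_eq) simp
  then show ?thesis using assms(1) by (simp add: mem_C_space_iff del: mspace_cfunspace)
qed

lemma add_in_C_space:
  assumes "compact K" "f \<in> C_space K" "g \<in> C_space K"
  shows "(\<lambda>x\<in>K. f x + g x) \<in> C_space K"
  using assms(2,3) unfolding mem_C_space_iff[OF assms(1)]
  by (intro restrict_in_C_space[OF assms(1), unfolded mem_C_space_iff[OF assms(1)]] continuous_intros) auto

lemma scale_in_C_space:
  assumes "compact K" "f \<in> C_space K"
  shows "(\<lambda>x\<in>K. c * f x) \<in> C_space K"
  using assms(2) unfolding mem_C_space_iff[OF assms(1)]
  by (intro restrict_in_C_space[OF assms(1), unfolded mem_C_space_iff[OF assms(1)]] continuous_intros) auto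

text \<open>Applied to \<open>f - g\<close>, the hypothesis \<open>bound\<close> makes the
  functional 1-Lipschitz and hence continuous; applied on the unit ball it gives norm at most 1,
  attained at the constant function 1.\<close>

lemma C_statesI:
  assumes K: "compact K" "K \<noteq> {}"
    and ext: "\<phi> \<in> extensional (C_space K)"
    and add: "\<And>f g. f \<in> C_space K \<Longrightarrow> g \<in> C_space K \<Longrightarrow> \<phi> (\<lambda>x\<in>K. f x + g x) = \<phi> f + \<phi> g"
    and scale: "\<And>c f. f \<in> C_space K \<Longrightarrow> \<phi> (\<lambda>x\<in>K. c * f x) = c * \<phi> f"
    and pos: "\<And>f. f \<in> C_space K \<Longrightarrow> (\<And>x. x \<in> K \<Longrightarrow> f x \<in> \<real>\<^sub>\<ge>\<^sub>0) \<Longrightarrow> \<phi> f \<in> \<real>\<^sub>\<ge>\<^sub>0"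
    and bound: "\<And>f B. f \<in> C_space K \<Longrightarrow> (\<And>x. x \<in> K \<Longrightarrow> norm (f x) \<le> B) \<Longrightarrow> norm (\<phi> f) \<le> B"
    and one: "\<phi> (\<lambda>x\<in>K. 1) = 1"
  shows "\<phi> \<in> C_states K"
proof -
  have "dist (\<phi> f) (\<phi> g) \<le> mdist (C_metric K) f g" if fg: "f \<in> C_space K" "g \<in> C_space K" for f g
  proof -
    let ?g = "\<lambda>x\<in>K. (-1) * g x"
    let ?h = "\<lambda>x\<in>K. f x + ?g x"
    have g': "?g \<in> C_space K"
      by (rule scale_in_C_space[OF K(1) fg(2)])
    have h: "?h \<in> C_space K"
      by (rule add_in_C_space[OF K(1) fg(1) g'])
    have "\<phi> ?h = \<phi> f - \<phi> g" using add[OF fg(1) g'] scale[OF fg(2), of "-1"] by simp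
    moreover have "norm (\<phi> ?h) \<le> mdist (C_metric K) f g"
    proof (rule bound[OF h])
      fix x assume x: "x \<in> K"
      have "mdist euclidean_metric (f x) (g x) \<le> mdist (C_metric K) f g"
        using x by (intro mdist_cfunspace_imp_mdist_le[OF fg]) auto
      then show "norm (?h x) \<le> mdist (C_metric K) f g" using x by (simp add: dist_norm)
    qed
    ultimately show ?thesis by (simp add: dist_norm)
  qed
  then have "Lipschitz_continuous_map (C_metric K) euclidean_metric \<phi>"
    unfolding Lipschitz_continuous_map_def
    by (intro conjI exI[of _ 1]) (auto simp del: mspace_cfunspace)
  then have "continuous_map (mtopology_of (C_metric K)) (mtopology_of euclidean_metric) \<phi>"
    by (rule Lipschitz_continuous_imp_continuous_map)
  then have dual: "\<phi> \<in> C_dual K"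
    using ext add scale by (simp add: C_dual_def del: mspace_cfunspace)
  have one_mem: "(\<lambda>x\<in>K. 1) \<in> C_space K"
    by (intro restrict_in_C_space K(1) continuous_on_const)
  have "(SUP f\<in>{f \<in> C_space K. \<forall>x\<in>K. norm (f x) \<le> 1}. norm (\<phi> f)) = 1"
  proof (rule cSup_eq_maximum)
    show "1 \<in> (\<lambda>f. norm (\<phi> f)) ` {f \<in> C_space K. \<forall>x\<in>K. norm (f x) \<le> 1}"
      using one one_mem by (intro image_eqI[of _ _ "\<lambda>x\<in>K. 1"]) (auto simp del: mspace_cfunspace)
  qed (use bound in \<open>auto simp del: mspace_cfunspace\<close>)
  then show ?thesis using dual pos by (simp add: C_states_def del: mspace_cfunspace)
qed

lemma integral_in_C_states:
  assumes K: "compact K" "K \<noteq> {}"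
    and sets: "sets M = sets (restrict_space borel K)" and prob: "emeasure M (space M) = 1"
  shows "(\<lambda>f\<in>C_space K. \<integral>x. f x \<partial>M) \<in> C_states K"
proof -
  interpret finite_measure M using prob by (intro finite_measureI) simp
  have space: "space M = K" using sets_eq_imp_space_eq[OF sets] by (simp add: space_restrict_space)
  have prob': "measure M K = 1" using prob by (simp add: space measure_def)
  note mem = mem_C_space_iff[OF K(1)]
  have int: "integrable M f" if f: "f \<in> C_space K" for f
  proof -
    have "continuous_on K f" using f by (simp add: mem)
    then have "f \<in> borel_measurable M" "bounded (f ` K)"
      using K(1) borel_measurable_continuous_on_restrict[of K f] measurable_cong_sets[OF sets refl]
      by (auto intro: compact_imp_bounded compact_continuous_image)
    then show ?thesis by (auto simp: bounded_iff space intro!: integrable_const_bound AE_I2)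
  qed
  note mems = add_in_C_space[OF K(1)] scale_in_C_space[OF K(1)]
  have restr: "(\<integral>x. (\<lambda>x\<in>K. h x) x \<partial>M) = (\<integral>x. h x \<partial>M)" for h :: "'a \<Rightarrow> complex"
    by (intro Bochner_Integration.integral_cong) (auto simp: space)
  have one: "(\<lambda>x\<in>K. 1) \<in> C_space K"
    by (intro restrict_in_C_space K(1) continuous_on_const)
  show ?thesis
  proof (rule C_statesI[OF K])
    fix f assume f: "f \<in> C_space K" and nonneg: "\<And>x. x \<in> K \<Longrightarrow> f x \<in> \<real>\<^sub>\<ge>\<^sub>0"
    \<comment> \<open>A nonnegative complex value equals its real part, so positivity becomes that
      of a real integral.\<close>
    have "(\<integral>x. f x \<partial>M) = (\<integral>x. complex_of_real (Re (f x)) \<partial>M)"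
      using nonneg by (intro Bochner_Integration.integral_cong) (auto simp: space complex_nonneg_Reals_iff complex_eq_iff)
    also have "\<dots> = complex_of_real (\<integral>x. Re (f x) \<partial>M)" by simp
    also have "\<dots> \<in> \<real>\<^sub>\<ge>\<^sub>0"
      using nonneg by (auto simp: space complex_nonneg_Reals_iff intro!: Bochner_Integration.integral_nonneg)
    finally show "(\<lambda>f\<in>C_space K. \<integral>x. f x \<partial>M) f \<in> \<real>\<^sub>\<ge>\<^sub>0" using f by (simp del: mspace_cfunspace)
  next
    fix f B assume f: "f \<in> C_space K" and B: "\<And>x. x \<in> K \<Longrightarrow> norm (f x) \<le> B"
    have "norm (\<integral>x. f x \<partial>M) \<le> (\<integral>x. norm (f x) \<partial>M)" by (rule integral_norm_bound)
    also have "\<dots> \<le> (\<integral>x. B \<partial>M)"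
      using B int[OF f] by (intro integral_mono) (auto simp: space)
    also have "\<dots> = B" by (simp add: space prob')
    finally show "norm ((\<lambda>f\<in>C_space K. \<integral>x. f x \<partial>M) f) \<le> B" using f by (simp del: mspace_cfunspace)
  qed (use mems int one in \<open>auto simp del: mspace_cfunspace simp: restr space prob'\<close>)
qed

lemma average_in_C_states:
  assumes K: "compact K" "K \<noteq> {}" and "finite I" "I \<noteq> {}" and p: "\<And>i. i \<in> I \<Longrightarrow> p i \<in> K"
  shows "(\<lambda>f\<in>C_space K. 1 / of_nat (card I) * (\<Sum>i\<in>I. f (p i))) \<in> C_states K"
proof -
  have card: "card I > 0" using assms(3,4) by (simp add: card_gt_0_iff)
  note mems = add_in_C_space[OF K(1)] scale_in_C_space[OF K(1)]
  have restr: "(\<Sum>i\<in>I. (\<lambda>x\<in>K. h x) (p i)) = (\<Sum>i\<in>I. h (p i))" for h :: "'a \<Rightarrow> complex"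
    using p by (intro sum.cong) auto
  have one: "(\<lambda>x\<in>K. 1) \<in> C_space K"
    by (intro restrict_in_C_space K(1) continuous_on_const)
  show ?thesis
  proof (rule C_statesI[OF K])
    fix f assume f: "f \<in> C_space K" and "\<And>x. x \<in> K \<Longrightarrow> f x \<in> \<real>\<^sub>\<ge>\<^sub>0"
    then have "(\<Sum>i\<in>I. f (p i)) \<in> \<real>\<^sub>\<ge>\<^sub>0"
      using p by (auto simp: complex_nonneg_Reals_iff intro!: sum_nonneg)
    then have "1 / of_nat (card I) * (\<Sum>i\<in>I. f (p i)) \<in> \<real>\<^sub>\<ge>\<^sub>0"
      by (intro nonneg_Reals_mult_I nonneg_Reals_divide_I) auto
    then show "(\<lambda>f\<in>C_space K. 1 / of_nat (card I) * (\<Sum>i\<in>I. f (p i))) f \<in> \<real>\<^sub>\<ge>\<^sub>0"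
      using f by (simp del: mspace_cfunspace)
  next
    fix f B assume f: "f \<in> C_space K" and B: "\<And>x. x \<in> K \<Longrightarrow> norm (f x) \<le> B"
    have "norm (\<Sum>i\<in>I. f (p i)) \<le> (\<Sum>i\<in>I. B)" using B p by (intro sum_norm_le) auto
    then have "norm (1 / of_nat (card I) * (\<Sum>i\<in>I. f (p i))) \<le> B"
      using card by (simp add: norm_mult norm_divide field_simps)
    then show "norm ((\<lambda>f\<in>C_space K. 1 / of_nat (card I) * (\<Sum>i\<in>I. f (p i))) f) \<le> B"
      using f by (simp del: mspace_cfunspace)
  qed (use mems one card in \<open>auto simp del: mspace_cfunspace restrict_apply
        simp: restrict_apply' restr sum.distrib distrib_left add_divide_distrib ac_simps simp flip: sum_distrib_left\<close>)
qed

text \<open>A cover whose measures add up to no more than the whole behaves as a partition: almost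
  every point lies in exactly one member. The integral then splits over the members, on each of
  which \<open>f\<close> is close to a constant.\<close>

lemma norm_integral_diff_cover_le:
  fixes f :: "'a \<Rightarrow> 'b::{banach, second_countable_topology}"
  assumes "finite_measure M" "finite I" and A: "\<And>i. i \<in> I \<Longrightarrow> A i \<in> sets M"
    and cover: "(\<Union>i\<in>I. A i) = space M"
    and disj: "(\<Sum>i\<in>I. measure M (A i)) \<le> measure M (space M)"
    and f: "integrable M f"
    and close: "\<And>i x. i \<in> I \<Longrightarrow> x \<in> A i \<Longrightarrow> norm (f x - c i) \<le> e"
  shows "norm ((\<integral>x. f x \<partial>M) - (\<Sum>i\<in>I. measure M (A i) *\<^sub>R c i)) \<le> (\<Sum>i\<in>I. measure M (A i)) * e"
proof -
  interpret finite_measure M by fact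
  define m where "m x = (\<Sum>i\<in>I. indicator (A i) x :: real)" for x
  have int_ind: "integrable M (indicator (A i) :: 'a \<Rightarrow> real)" if "i \<in> I" for i
    using A[OF that] by (intro integrable_real_indicator) (simp_all add: less_top[symmetric])
  have int_m: "integrable M m" unfolding m_def using int_ind by auto
  have integral_m: "(\<integral>x. m x \<partial>M) = (\<Sum>i\<in>I. measure M (A i))"
    unfolding m_def using int_ind A sets.sets_into_space
    by (subst Bochner_Integration.integral_sum) (auto intro!: sum.cong simp: Int_absorb2)
  have m1: "1 \<le> m x" if x: "x \<in> space M" for x
  proof -
    obtain i where i: "i \<in> I" "x \<in> A i" using x cover by blast
    have "indicator (A i) x \<le> m x"
      unfolding m_def using i \<open>finite I\<close> by (intro member_le_sum) auto
    then show ?thesis using i by simp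
  qed
  \<comment> \<open>the multiplicity is at least 1 and has mean at most 1\<close>
  have ae: "AE x in M. m x = 1"
  proof -
    have "(\<integral>x. m x - 1 \<partial>M) \<le> 0" using int_m disj by (simp add: integral_m)
    moreover have "0 \<le> (\<integral>x. m x - 1 \<partial>M)" using m1 by (intro Bochner_Integration.integral_nonneg) auto
    ultimately have "(\<integral>x. m x - 1 \<partial>M) = 0" by simp
    then have "AE x in M. m x - 1 = 0"
      using int_m m1 by (subst (asm) integral_nonneg_eq_0_iff_AE) auto
    then show ?thesis by simp
  qed
  have int_f: "integrable M (\<lambda>x. indicator (A i) x *\<^sub>R f x)" if "i \<in> I" for i
    using A[OF that] f by (rule integrable_mult_indicator)
  have int_c: "integrable M (\<lambda>x. indicator (A i) x *\<^sub>R c i)" if "i \<in> I" for i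
    using int_ind[OF that] by (rule integrable_scaleR_left)
  define g where "g x = (\<Sum>i\<in>I. indicator (A i) x *\<^sub>R f x - indicator (A i) x *\<^sub>R c i)" for x
  have "(\<integral>x. f x \<partial>M) = (\<integral>x. (\<Sum>i\<in>I. indicator (A i) x *\<^sub>R f x) \<partial>M)"
  proof (rule integral_cong_AE)
    show "AE x in M. f x = (\<Sum>i\<in>I. indicator (A i) x *\<^sub>R f x)"
      using ae by eventually_elim (simp add: m_def flip: scaleR_left.sum)
  qed (use f int_f in \<open>auto intro!: borel_measurable_integrable\<close>)
  moreover have "(\<Sum>i\<in>I. measure M (A i) *\<^sub>R c i) = (\<integral>x. (\<Sum>i\<in>I. indicator (A i) x *\<^sub>R c i) \<partial>M)"
    using int_c int_ind A sets.sets_into_space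
    by (subst Bochner_Integration.integral_sum) (auto intro!: sum.cong simp: Int_absorb2)
  ultimately have "(\<integral>x. f x \<partial>M) - (\<Sum>i\<in>I. measure M (A i) *\<^sub>R c i) = (\<integral>x. g x \<partial>M)"
    unfolding g_def sum_subtractf using int_f int_c by simp
  also have "norm \<dots> \<le> (\<integral>x. norm (g x) \<partial>M)" by (rule integral_norm_bound)
  also have "\<dots> \<le> (\<integral>x. m x * e \<partial>M)"
  proof (rule integral_mono)
    fix x
    have "norm (g x) \<le> (\<Sum>i\<in>I. indicator (A i) x * e)"
      unfolding g_def using close by (intro sum_norm_le) (auto simp: indicator_def)
    then show "norm (g x) \<le> m x * e" by (simp add: m_def sum_distrib_right)
  qed (use int_f int_c int_m in \<open>auto simp: g_def\<close>)
  also have "\<dots> = (\<Sum>i\<in>I. measure M (A i)) * e" using integral_m by simp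
  finally show ?thesis .
qed

section \<open>Convergence of the averages\<close>

lemma sets_SG_measure: "sets (SG_measure v) = sets (restrict_space borel (SG v))"
  by (simp add: SG_measure_def Let_def sets_restrict_space)

lemma space_SG_measure: "space (SG_measure v) = SG v"
  using sets_eq_imp_space_eq[OF sets_SG_measure] by (simp add: space_restrict_space)

lemma SG_borel: "SG v \<in> sets borel"
  by (intro borel_closed compact_imp_closed compact_SG)

lemma emeasure_SG_measure:
  assumes "A \<in> sets borel" "A \<subseteq> SG v"
  shows "emeasure (SG_measure v) A
    = hausdorff_outer (ln 3 / ln 2) A / hausdorff_outer (ln 3 / ln 2) (SG v)"
  using assms SG_borel[of v]
  by (simp add: SG_measure_def Let_def emeasure_restrict_space emeasure_hausdorff_measure
      divide_ennreal_def mult.commute)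

lemma emeasure_SG_measure_space:
  assumes "equilateral L v" "0 < L"
  shows "emeasure (SG_measure v) (SG v) = 1"
  using hausdorff_outer_SG_pos[OF assms] hausdorff_outer_SG_finite[of v]
  by (simp add: emeasure_SG_measure SG_borel ennreal_divide_self less_top)

lemma SG_cell_measurable: 
  assumes "js \<in> words n"
  shows "SG_word_map v js ` SG v \<in> sets borel" "SG_word_map v js ` SG v \<subseteq> SG v"
  using compact_SG_cell[of v js] SG_word_map_in_SG[OF assms]
  by (auto intro: borel_closed compact_imp_closed)

text \<open>Scaling bounds each of the \<open>3 ^ n\<close> cells by \<open>1 / 3 ^ n\<close>, while
  together they cover a set of mass 1. The nonnegative deficits therefore add up to at most 0, and
  each vanishes.\<close>

lemma measure_SG_cell:
  assumes "equilateral L v" "0 < L" and js: "js \<in> words n"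
  shows "measure (SG_measure v) (SG_word_map v js ` SG v) = 1 / 3 ^ n"
proof -
  let ?M = "SG_measure v" and ?A = "\<lambda>js. SG_word_map v js ` SG v"
  let ?h = "hausdorff_outer (ln 3 / ln 2) (SG v)"
  have one: "emeasure ?M (SG v) = 1" by (rule emeasure_SG_measure_space[OF assms(1,2)])
  interpret finite_measure ?M using one by (intro finite_measureI) (simp add: space_SG_measure)
  have sets: "?A ks \<in> sets ?M" if "ks \<in> words n" for ks
    using SG_cell_measurable[OF that] SG_borel[of v]
    by (simp add: sets_SG_measure sets_restrict_space_iff)
  have le: "measure ?M (?A ks) \<le> 1 / 3 ^ n" if ks: "ks \<in> words n" for ks
  proof -
    have "emeasure ?M (?A ks) \<le> (?h / 3 ^ n) / ?h"
      unfolding emeasure_SG_measure[OF SG_cell_measurable[OF ks]]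
      by (intro divide_right_mono_ennreal hausdorff_outer_SG_cell_le ks)
    also have "\<dots> = (?h / ?h) / 3 ^ n"
      by (simp add: divide_ennreal_def ac_simps)
    \<comment> \<open>Positivity and finiteness of the Hausdorff measure both enter here, since the
      quotient degenerates in \<open>ennreal\<close> for 0 and for \<open>top\<close>.\<close>
    also have "?h / ?h = 1"
      using hausdorff_outer_SG_pos[OF assms(1,2)] hausdorff_outer_SG_finite[of v]
      by (simp add: ennreal_divide_self less_top)
    also have "1 / 3 ^ n = ennreal (1 / 3 ^ n)"
      by (simp add: divide_ennreal[symmetric] ennreal_power[symmetric])
    finally show ?thesis by (simp add: emeasure_eq_measure)
  qed
  have "1 = measure ?M (\<Union>ks\<in>words n. ?A ks)"
    using one SG_eq_UN_cells[of v n] by (simp add: measure_def)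
  also have "\<dots> \<le> (\<Sum>ks\<in>words n. measure ?M (?A ks))"
    using sets by (intro finite_measure_subadditive_finite) auto
  finally have "(\<Sum>ks\<in>words n. 1 / 3 ^ n - measure ?M (?A ks)) \<le> 0"
    by (simp add: sum_subtractf card_words)
  moreover have "0 \<le> (\<Sum>ks\<in>words n. 1 / 3 ^ n - measure ?M (?A ks))"
    using le by (intro sum_nonneg) simp
  ultimately have "(\<Sum>ks\<in>words n. 1 / 3 ^ n - measure ?M (?A ks)) = 0" by simp
  then have "\<forall>ks\<in>words n. 1 / 3 ^ n - measure ?M (?A ks) = 0"
    using le by (subst (asm) sum_nonneg_eq_0_iff) auto
  with js show ?thesis by simp
qed

text \<open>This form removes the enumeration \<open>w\<close> and exhibits the average as a sum
  over cells, weighted by their masses, of mean midpoint values, ready for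
  \<open>norm_integral_diff_cover_le\<close>.\<close>

lemma psi_n_eq_sum_words:
  assumes "bij_betw (w n) {1..3^n} (words n)" "f \<in> C_space (SG v)"
  shows "psi_n v w n f = (\<Sum>js\<in>words n. (1 / 3 ^ n) *\<^sub>R ((\<Sum>j=1..3. f (side_midpoint v js j)) / 3))"
proof -
  have "psi_n v w n f = 1 / 3 ^ (n + 1) * (\<Sum>i=1..3^n. \<Sum>j=1..3. f (side_midpoint v (w n i) j))"
    using assms(2) unfolding psi_n_def by (rule restrict_apply')
  also have "(\<Sum>i=1..3^n. \<Sum>j=1..3. f (side_midpoint v (w n i) j)) = (\<Sum>js\<in>words n. \<Sum>j=1..3. f (side_midpoint v js j))"
    by (rule sum.reindex_bij_betw[OF assms(1)])
  finally show ?thesis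
    by (simp add: sum_distrib_left scaleR_conv_of_real sum_divide_distrib mult.commute)
qed

section \<open>The state property and weak-star convergence\<close>

lemma side_midpoint_in_SG:
  assumes "js \<in> words n" "j \<in> {1..3}"
  shows "side_midpoint v js j \<in> SG v"
  using side_midpoint_in_cell[OF assms(2)] SG_cell_measurable(2)[OF assms(1)] by blast

lemma SG_nonempty: "SG v \<noteq> {}"
  using vertex_in_SG[of 1 v] by auto

lemma psi_in_C_states:
  assumes "equilateral L v" "0 < L"
  shows "psi v \<in> C_states (SG v)"
  unfolding psi_def
  by (intro integral_in_C_states compact_SG SG_nonempty sets_SG_measure)
    (simp add: space_SG_measure emeasure_SG_measure_space[OF assms])

lemma psi_n_in_C_states:
  assumes "bij_betw (w n) {1..3^n} (words n)"
  shows "psi_n v w n \<in> C_states (SG v)"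
proof -
  \<comment> \<open>There are \<open>3 ^ n * 3\<close> index pairs, so the prefactor
    \<open>1 / 3 ^ (n + 1)\<close> makes the functional a plain average, with shared points counted
    repeatedly.\<close>
  let ?I = "{1..(3::nat)^n} \<times> {1..3::nat}" and ?p = "\<lambda>(i, j). side_midpoint v (w n i) j"
  have "(\<lambda>f\<in>C_space (SG v). 1 / of_nat (card ?I) * (\<Sum>x\<in>?I. f (?p x))) \<in> C_states (SG v)"
    using bij_betwE[OF assms]
    by (intro average_in_C_states compact_SG SG_nonempty) (auto intro!: side_midpoint_in_SG)
  also have "(\<lambda>f\<in>C_space (SG v). 1 / of_nat (card ?I) * (\<Sum>x\<in>?I. f (?p x))) = psi_n v w n"
    unfolding psi_n_def
    by (intro restrict_ext) (simp add: card_cartesian_product sum.cartesian_product split_def)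
  finally show ?thesis .
qed

text \<open>By uniform continuity \<open>f\<close> varies by less than \<open>e / 2\<close> on every
  cell of a sufficiently high level. The midpoints of a cell's triangle lie in that cell, so their
  mean value is within \<open>e / 2\<close> of \<open>f\<close> throughout it.\<close>

lemma psi_n_tendsto_psi:
  assumes v: "equilateral L v" "0 < L" and w: "\<And>n. bij_betw (w n) {1..3^n} (words n)"
    and f: "f \<in> C_space (SG v)"
  shows "(\<lambda>n. psi_n v w n f) \<longlonglongrightarrow> psi v f"
proof (rule metric_LIMSEQ_I)
  let ?M = "SG_measure v" and ?D = "diameter (SG v)" and ?A = "\<lambda>js. SG_word_map v js ` SG v"
  fix e :: real assume "0 < e"
  have one: "emeasure ?M (SG v) = 1" by (rule emeasure_SG_measure_space[OF v])
  interpret finite_measure ?M using one by (intro finite_measureI) (simp add: space_SG_measure)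
  have cont: "continuous_on (SG v) f"
    using f by (simp add: mem_C_space_iff[OF compact_SG] del: mspace_cfunspace)
  have bd: "bounded (SG v)" by (intro compact_imp_bounded compact_SG)
  have int: "integrable ?M f"
  proof -
    have "f \<in> borel_measurable ?M" "bounded (f ` SG v)"
      using borel_measurable_continuous_on_restrict[OF cont] measurable_cong_sets[OF sets_SG_measure refl]
        compact_continuous_image[OF cont compact_SG] by (auto intro: compact_imp_bounded)
    then show ?thesis by (auto simp: bounded_iff space_SG_measure intro!: integrable_const_bound AE_I2)
  qed
  obtain d where "0 < d"
    and d: "\<And>x y. x \<in> SG v \<Longrightarrow> y \<in> SG v \<Longrightarrow> dist y x < d \<Longrightarrow> dist (f y) (f x) < e / 2"
    using compact_uniformly_continuous[OF cont compact_SG] \<open>0 < e\<close>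
    unfolding uniformly_continuous_on_def by (metis half_gt_zero)
  obtain n0 where n0: "?D / d < 2 ^ n0" using real_arch_pow[of 2] by auto
  have "dist (psi_n v w n f) (psi v f) < e" if "n0 \<le> n" for n
  proof -
    have "(2::real) ^ n0 \<le> 2 ^ n" using that by simp
    with n0 have "?D / d < 2 ^ n" by linarith
    then have Dn: "?D / 2 ^ n < d" using \<open>0 < d\<close> by (simp add: field_simps)
    define c where "c js = (\<Sum>j=1..3. f (side_midpoint v js j)) / 3" for js
    have sets: "?A ks \<in> sets ?M" if "ks \<in> words n" for ks
      using SG_cell_measurable[OF that] SG_borel[of v]
      by (simp add: sets_SG_measure sets_restrict_space_iff)
    have close: "norm (f x - c js) \<le> e / 2" if js: "js \<in> words n" and x: "x \<in> ?A js" for js x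
    proof -
      have near: "norm (f x - f y) \<le> e / 2" if y: "y \<in> ?A js" for y
      proof -
        obtain x' y' where xy: "x = SG_word_map v js x'" "x' \<in> SG v" "y = SG_word_map v js y'" "y' \<in> SG v"
          using x y by blast
        have "dist x y = dist x' y' / 2 ^ n" using js by (simp add: xy dist_SG_word_map words_def)
        also have "\<dots> \<le> ?D / 2 ^ n"
          using xy bd by (intro divide_right_mono diameter_bounded_bound) auto
        finally have "dist x y < d" using Dn by simp
        moreover have "x \<in> SG v" "y \<in> SG v" using xy SG_word_map_in_SG[OF js] by auto
        ultimately show ?thesis using d[of y x] by (simp add: dist_norm)
      qed
      have "f x - c js = (\<Sum>j=1..3. f x - f (side_midpoint v js j)) / 3"
        by (simp add: c_def sum_subtractf diff_divide_distrib)
      also have "norm \<dots> \<le> (\<Sum>j=1..3::nat. e / 2) / 3"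
        using near side_midpoint_in_cell
        by (simp only: norm_divide norm_numeral) (intro divide_right_mono sum_norm_le; auto)
      finally show ?thesis by simp
    qed
    have sum: "(\<Sum>js\<in>words n. measure ?M (?A js)) = 1"
      using measure_SG_cell[OF v] by (simp add: card_words)
    have "measure ?M (SG v) = 1" using one by (simp add: measure_def)
    then have "norm ((\<integral>x. f x \<partial>?M) - (\<Sum>js\<in>words n. measure ?M (?A js) *\<^sub>R c js))
        \<le> (\<Sum>js\<in>words n. measure ?M (?A js)) * (e / 2)"
      using sets close int SG_eq_UN_cells[of v n]
      by (intro norm_integral_diff_cover_le finite_measure_axioms finite_words)
        (auto simp: sum space_SG_measure)
    moreover have "(\<Sum>js\<in>words n. measure ?M (?A js) *\<^sub>R c js) = psi_n v w n f"
      unfolding psi_n_eq_sum_words[of w, OF w f] c_def using measure_SG_cell[OF v] by simp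
    moreover have "psi v f = (\<integral>x. f x \<partial>?M)"
      using f unfolding psi_def by (rule restrict_apply')
    ultimately have "dist (psi_n v w n f) (psi v f) \<le> e / 2"
      by (simp add: sum dist_norm norm_minus_commute)
    with \<open>0 < e\<close> show ?thesis by simp
  qed
  then show "\<exists>n0. \<forall>n\<ge>n0. dist (psi_n v w n f) (psi v f) < e" by blast
qed

lemma C_states_subset_C_dual: "C_states K \<subseteq> C_dual K"
  by (auto simp: C_states_def)

text \<open>Convergence in a product topology is componentwise, the components being evaluations;
  extensionality of the functionals places them in the product.\<close>

lemma limitin_weak_star:
  assumes "\<phi> \<in> C_dual K" "\<And>n. \<phi>' n \<in> C_dual K"
    and "\<And>f. f \<in> C_space K \<Longrightarrow> (\<lambda>n. \<phi>' n f) \<longlonglongrightarrow> \<phi> f"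
  shows "limitin (weak_star K) \<phi>' \<phi> sequentially"
proof -
  have ext: "\<psi> \<in> extensional (C_space K)" if "\<psi> \<in> C_dual K" for \<psi>
    using that by (simp add: C_dual_def del: mspace_cfunspace)
  then have "\<psi> \<in> topspace (product_topology (\<lambda>_. euclidean) (C_space K))" if "\<psi> \<in> C_dual K" for \<psi>
    using that by (simp add: PiE_def del: mspace_cfunspace)
  then show ?thesis
    using assms ext unfolding weak_star_def limitin_subtopology limitin_componentwise
    by (auto simp del: mspace_cfunspace topspace_product_topology)
qed

theorem proposition8p6:
  fixes v :: "nat \<Rightarrow> plane" and w :: "nat \<Rightarrow> nat \<Rightarrow> nat list"
  assumes "equilateral (2 * pi / 3) v"
    and "\<And>n. bij_betw (w n) {1..3^n} (words n)"
  shows "psi v \<in> C_states (SG v) \<and>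
         (\<forall>n. psi_n v w n \<in> C_states (SG v)) \<and>
         limitin (weak_star (SG v)) (\<lambda>n. psi_n v w n) (psi v) sequentially"
proof -
  have L: "0 < 2 * pi / 3" by simp
  have psi: "psi v \<in> C_states (SG v)" by (rule psi_in_C_states[OF assms(1) L])
  have psi_n: "psi_n v w n \<in> C_states (SG v)" for n by (rule psi_n_in_C_states[of w, OF assms(2)])
  have "limitin (weak_star (SG v)) (\<lambda>n. psi_n v w n) (psi v) sequentially"
    using psi psi_n C_states_subset_C_dual[of "SG v"]
    by (intro limitin_weak_star psi_n_tendsto_psi[OF assms(1) L assms(2)]) auto
  with psi psi_n show ?thesis by blast
qed

end
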